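(* Let $F:\Pi_{\mathbb{BC}^+}\to\mathbb{BC}$ be a bicomplex holomorphic function on the bicomplex upper half-plane $\Pi_{\mathbb{BC}^+}$. Write $Z=x_0+ix_1+jx_2+kx_3$ with $x_0,x_1,x_2,x_3$ real, so that $Z\in \Pi_{\mathbb{BC}^+}$ if and only if $x_1>|x_2|$, and suppose that $$\sup_{x_1>|x_2|}{}_{\mathbb{D}}\ \frac{1}{2\pi}\int_{(-\infty,\infty)_{\mathbb{D}}}\|F(Z)\|_k^2\,dx_0 = M<\infty ,$$ where $\sup_{\mathbb D}$ is the $\mathbb{D}$-supremum and the integral is the $\mathbb{D}$-integral along the horizontal line determined by $(x_1,x_2)$. Then there exists $\mathfrak{F}\in L_k^2\big((-\infty,\infty)_{\mathbb{D}},dm\big)$ such that $$F(Z)=\int_{(0,\infty)_{\mathbb{D}}}\mathfrak{F}(t)\exp\{itZ\}\,dt\odot dt^{\dagger}\qquad\text{for all } Z\in\Pi_{\mathbb{BC}^+},$$ and $$\int_{(0,\infty)_{\mathbb{D}}}\|\mathfrak{F}(t)\|_k^2\,dt\odot dt^\dagger=M .$$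
   Context: Bicomplex numbers: $\mathbb{BC}=\{z_1+jz_2: z_1,z_2\in\mathbb{C}\}$, where $\mathbb{C}=\mathbb{C}(i)$, $i^2=j^2=-1$, $ij=ji=k$, $k^2=1$ (a commutative ring). Put $e=\frac{1+ij}{2}$, $e^\dagger=\frac{1-ij}{2}$; these are idempotents with $e e^\dagger=0$, $e+e^\dagger=1$. Every $Z=z_1+jz_2$ is uniquely $Z=e\beta_1+e^\dagger\beta_2$ with $\beta_1=z_1-iz_2$, $\beta_2=z_1+iz_2\in\mathbb{C}$; algebraic operations and $\exp$ act componentwise. If $Z=x_0+ix_1+jx_2+kx_3$, then $\beta_1=(x_0+x_3)+i(x_1-x_2)$ and $\beta_2=(x_0-x_3)+i(x_1+x_2)$. Hyperbolic numbers: $\mathbb{D}=\{a+kb:a,b\in\mathbb{R}\}=\{e s_1+e^\dagger s_2: s_1,s_2\in\mathbb{R}\}$. Inequalities, finiteness and suprema in $\mathbb{D}$ (the $\mathbb{D}$-supremum) are taken componentwise with respect to $e,e^\dagger$. The hyperbolic norm is $\|e\beta_1+e^\dagger\beta_2\|_k=e|\beta_1|+e^\dagger|\beta_2|\in\mathbb{D}$. Upper half-plane: $\Pi_{\mathbb{BC}^+}=\{e\beta_1+e^\dagger\beta_2:\operatorname{Im}\beta_1>0,\ \operatorname{Im}\beta_2>0\}$. A function $F$ on $\Pi_{\mathbb{BC}^+}$ is bicomplex holomorphic if and only if $F(e\beta_1+e^\dagger\beta_2)=eF_1(\beta_1)+e^\dagger F_2(\beta_2)$ with $F_1,F_2$ holomorphic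 on the complex upper half-plane. Intervals and integrals: for $-\infty\le a<b\le\infty$, $(a,b)_{\mathbb{D}}=e(a,b)+e^\dagger(a,b)$. For a product-type function $G(es_1+e^\dagger s_2)=eG_1(s_1)+e^\dagger G_2(s_2)$, the $\mathbb{D}$-integral is $\int_{(a,b)_{\mathbb{D}}}G(t)\,dt\odot dt^\dagger=e\int_a^bG_1(s)\,ds+e^\dagger\int_a^bG_2(s)\,ds$. In particular, for fixed $x_1>|x_2|$, $$\int_{(-\infty,\infty)_{\mathbb{D}}}\|F(Z)\|_k^2\,dx_0=e\int_{-\infty}^\infty|F_1(s+i(x_1-x_2))|^2ds+e^\dagger\int_{-\infty}^\infty|F_2(s+i(x_1+x_2))|^2ds ,$$ and $\int_{(0,\infty)_{\mathbb{D}}}\mathfrak{F}(t)\exp\{itZ\}\,dt\odot dt^\dagger=e\int_0^\infty\mathfrak{F}_1(t)e^{it\beta_1}dt+e^\dagger\int_0^\infty\mathfrak{F}_2(t)e^{it\beta_2}dt$. $L_k^2((-\infty,\infty)_{\mathbb{D}},dm)=eL^2(\mathbb{R})+e^\dagger L^2(\mathbb{R})$ (product-type functions $\mathfrak F=e\mathfrak{F}_1+e^\dagger\mathfrak{F}_2$ with $\mathfrak{F}_1,\mathfrak{F}_2\in L^2(\mathbb{R})$ for Lebesgue measure). *)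

theory Defs
  imports "HOL-Analysis.Analysis"
begin

section \<open>Bicomplex numbers\<close>

text \<open>\<open>Bicomplex z\<^sub>1 z\<^sub>2\<close> stands for \<open>z\<^sub>1 + j z\<^sub>2\<close>; \<open>beta1\<close> and \<open>beta2\<close> are the coordinates with
  respect to the idempotents \<open>e = (1 + ij)/2\<close> and \<open>e\<^sup>\<dagger> = (1 - ij)/2\<close>.\<close>

datatype bicomplex = Bicomplex (bc_fst: complex) (bc_snd: complex)

definition beta1 :: "bicomplex \<Rightarrow> complex" where
  "beta1 Z = bc_fst Z - \<i> * bc_snd Z"

definition beta2 :: "bicomplex \<Rightarrow> complex" where
  "beta2 Z = bc_fst Z + \<i> * bc_snd Z"

lemma bicomplex_eq_iff_beta: "Z = W \<longleftrightarrow> beta1 Z = beta1 W \<and> beta2 Z = beta2 W"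
proof
  assume h: "beta1 Z = beta1 W \<and> beta2 Z = beta2 W"
  have "2 * bc_fst Z = beta1 Z + beta2 Z" "2 * bc_fst W = beta1 W + beta2 W"
    "2 * \<i> * bc_snd Z = beta2 Z - beta1 Z" "2 * \<i> * bc_snd W = beta2 W - beta1 W"
    by (simp_all add: beta1_def beta2_def)
  with h have "2 * bc_fst Z = 2 * bc_fst W" "2 * \<i> * bc_snd Z = 2 * \<i> * bc_snd W"
    by metis+
  then show "Z = W" by (auto intro: bicomplex.expand)
qed simp

text \<open>The norm below is equivalent to the Euclidean one on \<open>\<real>\<^sup>4\<close>, so the topology is the usual one;
  it is chosen because it is submultiplicative, which the Euclidean norm is not.  This makes the
  bicomplex numbers a Banach algebra, and the library's \<open>exp\<close> the bicomplex exponential.\<close>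

instantiation bicomplex :: "{comm_ring_1, inverse, real_normed_algebra_1}"
begin

definition "0 = Bicomplex 0 0"
definition "1 = Bicomplex 1 0"
definition "Z + W = Bicomplex (bc_fst Z + bc_fst W) (bc_snd Z + bc_snd W)"
definition "- Z = Bicomplex (- bc_fst Z) (- bc_snd Z)"
definition "Z - W = Bicomplex (bc_fst Z - bc_fst W) (bc_snd Z - bc_snd W)"
definition "Z * W = Bicomplex (bc_fst Z * bc_fst W - bc_snd Z * bc_snd W)
                              (bc_fst Z * bc_snd W + bc_snd Z * bc_fst W)"
definition "r *\<^sub>R Z = Bicomplex (r *\<^sub>R bc_fst Z) (r *\<^sub>R bc_snd Z)"

text \<open>The inverse of \<open>z\<^sub>1 + j z\<^sub>2\<close> is \<open>(z\<^sub>1 - j z\<^sub>2) / (z\<^sub>1\<^sup>2 + z\<^sub>2\<^sup>2)\<close>.  It is meaningful only if \<open>Z\<close>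
  is neither zero nor a zero divisor; otherwise the value is \<open>0\<close>.\<close>

definition "inverse Z = Bicomplex (bc_fst Z / ((bc_fst Z)\<^sup>2 + (bc_snd Z)\<^sup>2))
                                  (- bc_snd Z / ((bc_fst Z)\<^sup>2 + (bc_snd Z)\<^sup>2))"
definition "Z div W = Z * inverse W" for Z W :: bicomplex

definition "norm Z = max (cmod (beta1 Z)) (cmod (beta2 Z))"
definition "sgn Z = inverse (norm Z) *\<^sub>R Z" for Z :: bicomplex
definition "dist Z W = norm (Z - W)" for Z W :: bicomplex
definition "uniformity = (INF \<epsilon>\<in>{0<..}. principal {(Z, W :: bicomplex). dist Z W < \<epsilon>})"
definition "open U \<longleftrightarrow> (\<forall>Z\<in>U. eventually (\<lambda>(Z', W). Z' = Z \<longrightarrow> W \<in> U) uniformity)"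
  for U :: "bicomplex set"

lemma beta_simps [simp]:
  "beta1 0 = 0" "beta2 0 = 0" "beta1 1 = 1" "beta2 1 = 1"
  "beta1 (Z + W) = beta1 Z + beta1 W" "beta2 (Z + W) = beta2 Z + beta2 W"
  "beta1 (Z - W) = beta1 Z - beta1 W" "beta2 (Z - W) = beta2 Z - beta2 W"
  "beta1 (- Z) = - beta1 Z" "beta2 (- Z) = - beta2 Z"
  "beta1 (Z * W) = beta1 Z * beta1 W" "beta2 (Z * W) = beta2 Z * beta2 W"
  "beta1 (r *\<^sub>R Z) = r *\<^sub>R beta1 Z" "beta2 (r *\<^sub>R Z) = r *\<^sub>R beta2 Z"
  by (simp_all add: beta1_def beta2_def zero_bicomplex_def one_bicomplex_def plus_bicomplex_def
      minus_bicomplex_def uminus_bicomplex_def times_bicomplex_def scaleR_bicomplex_def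
      algebra_simps scaleR_conv_of_real)

instance
proof
  fix Z W :: bicomplex and r :: real
  show "norm (Z + W) \<le> norm Z + norm W"
    using norm_triangle_ineq[of "beta1 Z" "beta1 W"] norm_triangle_ineq[of "beta2 Z" "beta2 W"]
    by (auto simp: norm_bicomplex_def)
  show "norm (r *\<^sub>R Z) = \<bar>r\<bar> * norm Z"
    by (simp add: norm_bicomplex_def max_mult_distrib_left)
  show "norm (Z * W) \<le> norm Z * norm W"
    unfolding norm_bicomplex_def beta_simps norm_mult
    by (intro max.boundedI mult_mono max.cobounded1 max.cobounded2 norm_ge_zero max.coboundedI1)
  show "(norm Z = 0) = (Z = 0)"
    unfolding bicomplex_eq_iff_beta by (auto simp: norm_bicomplex_def max_def
        order.antisym[OF _ norm_ge_zero])
qed (simp_all add: bicomplex_eq_iff_beta algebra_simps dist_bicomplex_def sgn_bicomplex_def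
      uniformity_bicomplex_def open_bicomplex_def norm_bicomplex_def divide_bicomplex_def)

end

definition bc_of_complex :: "complex \<Rightarrow> bicomplex" where
  "bc_of_complex z = Bicomplex z 0"

definition bc_i :: bicomplex where "bc_i = bc_of_complex \<i>"
definition bc_j :: bicomplex where "bc_j = Bicomplex 0 1"
definition bc_k :: bicomplex where "bc_k = bc_i * bc_j"

definition bc_e :: bicomplex where "bc_e = (1 + bc_i * bc_j) /\<^sub>R 2"
definition bc_ed :: bicomplex where "bc_ed = (1 - bc_i * bc_j) /\<^sub>R 2"

lemma beta_of_real [simp]: "beta1 (of_real r) = of_real r" "beta2 (of_real r) = of_real r"
  by (simp_all add: of_real_def)

lemma beta_units [simp]:
  "beta1 (bc_of_complex z) = z" "beta2 (bc_of_complex z) = z"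
  "beta1 bc_i = \<i>" "beta2 bc_i = \<i>" "beta1 bc_j = - \<i>" "beta2 bc_j = \<i>"
  "beta1 bc_k = 1" "beta2 bc_k = -1"
  "beta1 bc_e = 1" "beta2 bc_e = 0" "beta1 bc_ed = 0" "beta2 bc_ed = 1"
  by (simp_all add: bc_of_complex_def bc_i_def bc_j_def bc_k_def bc_e_def bc_ed_def)
     (simp_all add: beta1_def beta2_def scaleR_conv_of_real)

lemma bicomplex_decomp:
  "Z = bc_e * bc_of_complex (beta1 Z) + bc_ed * bc_of_complex (beta2 Z)"
  by (simp add: bicomplex_eq_iff_beta)

lemma beta_inverse:
  assumes "beta1 Z \<noteq> 0" "beta2 Z \<noteq> 0"
  shows "beta1 (inverse Z) = inverse (beta1 Z)" "beta2 (inverse Z) = inverse (beta2 Z)"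
proof -
  have n: "(bc_fst Z)\<^sup>2 + (bc_snd Z)\<^sup>2 = beta1 Z * beta2 Z"
    by (simp add: beta1_def beta2_def algebra_simps power2_eq_square)
  have "beta1 (inverse Z) = beta2 Z / (beta1 Z * beta2 Z)"
    unfolding inverse_bicomplex_def n by (simp add: beta1_def beta2_def add_divide_distrib)
  then show "beta1 (inverse Z) = inverse (beta1 Z)"
    using assms by (simp add: divide_simps)
  have "beta2 (inverse Z) = beta1 Z / (beta1 Z * beta2 Z)"
    unfolding inverse_bicomplex_def n by (simp add: beta1_def beta2_def diff_divide_distrib)
  then show "beta2 (inverse Z) = inverse (beta2 Z)"
    using assms by (simp add: divide_simps)
qed

lemma is_unit_bicomplex_iff: "(Z :: bicomplex) dvd 1 \<longleftrightarrow> beta1 Z \<noteq> 0 \<and> beta2 Z \<noteq> 0"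
proof
  assume "Z dvd 1"
  then obtain W where "1 = Z * W" by (elim dvdE)
  then show "beta1 Z \<noteq> 0 \<and> beta2 Z \<noteq> 0"
    by (auto simp: bicomplex_eq_iff_beta)
next
  assume "beta1 Z \<noteq> 0 \<and> beta2 Z \<noteq> 0"
  then have "1 = Z * inverse Z" by (simp add: bicomplex_eq_iff_beta beta_inverse)
  then show "Z dvd 1" by (rule dvdI)
qed

lemma bounded_linear_beta: "bounded_linear beta1" "bounded_linear beta2"
  by (rule bounded_linear_intro[where K = 1]; simp add: norm_bicomplex_def)+

lemma tendsto_bicomplex_iff:
  "(f \<longlongrightarrow> L) A \<longleftrightarrow>
     ((\<lambda>x. beta1 (f x)) \<longlongrightarrow> beta1 L) A \<and> ((\<lambda>x. beta2 (f x)) \<longlongrightarrow> beta2 L) A"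
proof
  assume "(f \<longlongrightarrow> L) A"
  then show "((\<lambda>x. beta1 (f x)) \<longlongrightarrow> beta1 L) A \<and> ((\<lambda>x. beta2 (f x)) \<longlongrightarrow> beta2 L) A"
    using bounded_linear_beta by (auto intro: bounded_linear.tendsto)
next
  assume h: "((\<lambda>x. beta1 (f x)) \<longlongrightarrow> beta1 L) A \<and> ((\<lambda>x. beta2 (f x)) \<longlongrightarrow> beta2 L) A"
  show "(f \<longlongrightarrow> L) A"
  proof (rule tendstoI)
    fix r :: real assume "0 < r"
    then have "\<forall>\<^sub>F x in A. dist (beta1 (f x)) (beta1 L) < r" "\<forall>\<^sub>F x in A. dist (beta2 (f x)) (beta2 L) < r"
      using h by (auto dest: tendstoD)
    then show "\<forall>\<^sub>F x in A. dist (f x) L < r"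
      by eventually_elim (simp add: dist_norm norm_bicomplex_def)
  qed
qed

instance bicomplex :: banach
proof
  fix X :: "nat \<Rightarrow> bicomplex" assume "Cauchy X"
  then have "Cauchy (\<lambda>n. beta1 (X n))" "Cauchy (\<lambda>n. beta2 (X n))"
    using bounded_linear_beta by (auto intro: bounded_linear.Cauchy)
  then obtain a b where "(\<lambda>n. beta1 (X n)) \<longlonglongrightarrow> a" "(\<lambda>n. beta2 (X n)) \<longlonglongrightarrow> b"
    by (meson Cauchy_convergent convergentD)
  then have "X \<longlonglongrightarrow> bc_e * bc_of_complex a + bc_ed * bc_of_complex b"
    by (simp add: tendsto_bicomplex_iff)
  then show "convergent X" by (rule convergentI)
qed

lemma beta_power [simp]: "beta1 (Z ^ n) = beta1 Z ^ n" "beta2 (Z ^ n) = beta2 Z ^ n"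
  by (induction n) simp_all

lemma beta_exp [simp]: "beta1 (exp Z) = exp (beta1 Z)" "beta2 (exp Z) = exp (beta2 Z)"
proof -
  have "(\<lambda>n. beta1 (Z ^ n /\<^sub>R fact n)) sums beta1 (exp Z)"
    "(\<lambda>n. beta2 (Z ^ n /\<^sub>R fact n)) sums beta2 (exp Z)"
    by (rule bounded_linear.sums[OF bounded_linear_beta(1) exp_converges]
             bounded_linear.sums[OF bounded_linear_beta(2) exp_converges])+
  then show "beta1 (exp Z) = exp (beta1 Z)" "beta2 (exp Z) = exp (beta2 Z)"
    by (simp_all, (metis exp_converges sums_unique2)+)
qed

definition bc_upper_half_plane :: "bicomplex set" where
  "bc_upper_half_plane = {Z. Im (beta1 Z) > 0 \<and> Im (beta2 Z) > 0}"

lemma bc_upper_half_plane_iff: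
  "of_real x0 + bc_i * of_real x1 + bc_j * of_real x2 + bc_k * of_real x3 \<in> bc_upper_half_plane
     \<longleftrightarrow> x1 > \<bar>x2\<bar>"
  by (auto simp: bc_upper_half_plane_def)


section \<open>Bicomplex holomorphic functions\<close>

text \<open>As usual in bicomplex analysis, the difference quotient is taken only along increments
  \<open>W - Z\<close> that are neither zero nor zero divisors.\<close>

definition bc_holomorphic_on :: "(bicomplex \<Rightarrow> bicomplex) \<Rightarrow> bicomplex set \<Rightarrow> bool" where
  "bc_holomorphic_on F S \<longleftrightarrow>
     (\<forall>Z\<in>S. \<exists>D. ((\<lambda>W. (F W - F Z) / (W - Z)) \<longlongrightarrow> D) (at Z within {W\<in>S. (W - Z) dvd 1}))"

lemma bc_quotient_within:
  fixes F :: "bicomplex \<Rightarrow> bicomplex"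
  shows "((\<lambda>W. (F W - F Z) / (W - Z)) \<longlongrightarrow> D) (at Z within {W\<in>S. (W - Z) dvd 1}) \<longleftrightarrow>
    ((\<lambda>W. (beta1 (F W) - beta1 (F Z)) / (beta1 W - beta1 Z)) \<longlongrightarrow> beta1 D)
       (at Z within {W\<in>S. (W - Z) dvd 1}) \<and>
    ((\<lambda>W. (beta2 (F W) - beta2 (F Z)) / (beta2 W - beta2 Z)) \<longlongrightarrow> beta2 D)
       (at Z within {W\<in>S. (W - Z) dvd 1})"
proof -
  have *: "\<forall>\<^sub>F W in at Z within {W\<in>S. (W - Z) dvd 1}.
      beta1 ((F W - F Z) / (W - Z)) = (beta1 (F W) - beta1 (F Z)) / (beta1 W - beta1 Z) \<and>
      beta2 ((F W - F Z) / (W - Z)) = (beta2 (F W) - beta2 (F Z)) / (beta2 W - beta2 Z)"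
    unfolding eventually_at_filter
    by (rule always_eventually)
       (auto simp: is_unit_bicomplex_iff divide_bicomplex_def beta_inverse divide_simps)
  show ?thesis
    unfolding tendsto_bicomplex_iff
    by (intro arg_cong2[where f = "(\<and>)"] tendsto_cong; use * in eventually_elim; simp)
qed

lemma bc_holomorphic_on_imp_decomp:
  assumes F: "bc_holomorphic_on F bc_upper_half_plane"
  shows "\<exists>F1 F2. F1 holomorphic_on {z. Im z > 0} \<and> F2 holomorphic_on {z. Im z > 0} \<and>
    (\<forall>z1 z2. Im z1 > 0 \<longrightarrow> Im z2 > 0 \<longrightarrow>
       F (bc_e * bc_of_complex z1 + bc_ed * bc_of_complex z2) =
         bc_e * bc_of_complex (F1 z1) + bc_ed * bc_of_complex (F2 z2))"
proof -
  define H where "H = {z. Im z > 0}"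
  define P where "P z w = bc_e * bc_of_complex z + bc_ed * bc_of_complex w" for z w
  have P [simp]: "beta1 (P z w) = z" "beta2 (P z w) = w" for z w
    by (simp_all add: P_def)
  have PH: "P z w \<in> bc_upper_half_plane \<longleftrightarrow> z \<in> H \<and> w \<in> H" for z w
    by (simp add: bc_upper_half_plane_def H_def)
  have oH: "open H" unfolding H_def by (rule open_halfspace_Im_gt)
  have cH: "convex H" unfolding H_def by (rule convex_halfspace_Im_gt)
  let ?A = "\<lambda>z w. at (P z w) within {W \<in> bc_upper_half_plane. (W - P z w) dvd 1}"
  have lim: "\<exists>d1 d2. ((\<lambda>W. (beta1 (F W) - beta1 (F (P z w))) / (beta1 W - z)) \<longlongrightarrow> d1) (?A z w)
     \<and> ((\<lambda>W. (beta2 (F W) - beta2 (F (P z w))) / (beta2 W - w)) \<longlongrightarrow> d2) (?A z w)"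
    if "z \<in> H" "w \<in> H" for z w
  proof -
    have "P z w \<in> bc_upper_half_plane" using that by (simp add: PH)
    then obtain D where "((\<lambda>W. (F W - F (P z w)) / (W - P z w)) \<longlongrightarrow> D) (?A z w)"
      using F unfolding bc_holomorphic_on_def by blast
    then show ?thesis unfolding bc_quotient_within P by blast
  qed
  have tA: "filterlim (\<lambda>h. P (z + a h) (w + b h)) (?A z w) (at 0)"
    if zw: "z \<in> H" "w \<in> H" and a: "(a \<longlongrightarrow> 0) (at 0)" and b: "(b \<longlongrightarrow> 0) (at (0::complex))"
      and nz: "\<forall>\<^sub>F h in at 0. a h \<noteq> 0 \<and> b h \<noteq> 0" for z w a b
  proof -
    have l: "((\<lambda>h. z + a h) \<longlongrightarrow> z) (at 0)" "((\<lambda>h. w + b h) \<longlongrightarrow> w) (at 0)"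
      using tendsto_add[OF tendsto_const a, of z] tendsto_add[OF tendsto_const b, of w] by simp_all
    then have "((\<lambda>h. P (z + a h) (w + b h)) \<longlongrightarrow> P z w) (at 0)"
      by (simp add: tendsto_bicomplex_iff)
    moreover have "\<forall>\<^sub>F h in at 0. z + a h \<in> H" "\<forall>\<^sub>F h in at 0. w + b h \<in> H"
      using l oH zw by (auto intro: topological_tendstoD)
    then have "\<forall>\<^sub>F h in at 0. P (z + a h) (w + b h) \<in>
       {W \<in> bc_upper_half_plane. (W - P z w) dvd 1} \<and> P (z + a h) (w + b h) \<noteq> P z w"
      using nz
      by eventually_elim (auto simp: PH is_unit_bicomplex_iff bicomplex_eq_iff_beta)
    ultimately show ?thesis
      by (auto simp: filterlim_at)
  qed
  have id0: "((\<lambda>h::complex. h) \<longlongrightarrow> 0) (at 0)" by (rule tendsto_ident_at)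
  have nz0: "\<forall>\<^sub>F h in at (0::complex). h \<noteq> 0 \<and> h \<noteq> 0"
    by (simp add: eventually_at_filter)
  text \<open>Each component is independent of the other variable: the increment of \<open>beta2 \<circ> F\<close> is
    \<open>O(beta2 W - beta2 Z)\<close> near \<open>Z\<close>, uniformly in \<open>beta1 W\<close>.\<close>
  have cont: "\<exists>r>0. \<forall>a. a \<noteq> 0 \<longrightarrow> cmod a < r \<longrightarrow>
      ((\<lambda>h. beta2 (F (P (z + a + h) (w + h)))) \<longlongrightarrow> beta2 (F (P z w))) (at 0) \<and>
      ((\<lambda>h. beta1 (F (P (z + h) (w + a + h)))) \<longlongrightarrow> beta1 (F (P z w))) (at 0)"
    if zw: "z \<in> H" "w \<in> H" for z w
  proof -
    obtain d1 d2 where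
      d1: "((\<lambda>W. (beta1 (F W) - beta1 (F (P z w))) / (beta1 W - z)) \<longlongrightarrow> d1) (?A z w)" and
      d2: "((\<lambda>W. (beta2 (F W) - beta2 (F (P z w))) / (beta2 W - w)) \<longlongrightarrow> d2) (?A z w)"
      using lim[OF zw] by blast
    have "\<forall>\<^sub>F W in ?A z w.
        dist ((beta1 (F W) - beta1 (F (P z w))) / (beta1 W - z)) d1 < 1 \<and>
        dist ((beta2 (F W) - beta2 (F (P z w))) / (beta2 W - w)) d2 < 1"
      using tendstoD[OF d1, of 1] tendstoD[OF d2, of 1] by (simp add: eventually_conj_iff)
    then obtain r0 where r0: "r0 > 0"
      and b0: "\<forall>W\<in>{W \<in> bc_upper_half_plane. (W - P z w) dvd 1}.
        W \<noteq> P z w \<and> dist W (P z w) < r0 \<longrightarrow>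
        dist ((beta1 (F W) - beta1 (F (P z w))) / (beta1 W - z)) d1 < 1 \<and>
        dist ((beta2 (F W) - beta2 (F (P z w))) / (beta2 W - w)) d2 < 1"
      unfolding eventually_at by blast
    have b: "\<lbrakk>W \<in> bc_upper_half_plane; (W - P z w) dvd 1; dist W (P z w) < r0\<rbrakk> \<Longrightarrow>
        dist ((beta1 (F W) - beta1 (F (P z w))) / (beta1 W - z)) d1 < 1 \<and>
        dist ((beta2 (F W) - beta2 (F (P z w))) / (beta2 W - w)) d2 < 1" for W
      using b0 by (cases "W = P z w") (auto simp: is_unit_bicomplex_iff)
    obtain r1 where r1: "r1 > 0" "ball z r1 \<subseteq> H" using oH zw openE by blast
    obtain r2 where r2: "r2 > 0" "ball w r2 \<subseteq> H" using oH zw openE by blast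
    define r where "r = Min {r0, r1, r2}"
    have r: "r > 0" "r \<le> r0" "r \<le> r1" "r \<le> r2" using r0 r1 r2 by (auto simp: r_def)
    have bound: "cmod (beta1 (F (P (z + p) (w + q))) - beta1 (F (P z w))) \<le> (cmod d1 + 1) * cmod p \<and>
        cmod (beta2 (F (P (z + p) (w + q))) - beta2 (F (P z w))) \<le> (cmod d2 + 1) * cmod q"
      if "p \<noteq> 0" "q \<noteq> 0" "cmod p < r" "cmod q < r" for p q
    proof -
      have "z + p \<in> ball z r1" "w + q \<in> ball w r2"
        using r that by (simp_all add: dist_norm)
      then have "z + p \<in> H" "w + q \<in> H"
        using r1(2) r2(2) by blast+
      then have "P (z + p) (w + q) \<in> bc_upper_half_plane" by (simp add: PH)
      moreover have "(P (z + p) (w + q) - P z w) dvd 1"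
        using that by (simp add: is_unit_bicomplex_iff)
      moreover have "dist (P (z + p) (w + q)) (P z w) < r0"
        using that r by (simp add: dist_norm norm_bicomplex_def)
      ultimately have *: "cmod ((beta1 (F (P (z + p) (w + q))) - beta1 (F (P z w))) / p - d1) < 1"
         "cmod ((beta2 (F (P (z + p) (w + q))) - beta2 (F (P z w))) / q - d2) < 1"
        using b[of "P (z + p) (w + q)"] by (simp_all add: dist_norm)
      have gen: "cmod x \<le> (cmod d + 1) * cmod s" if "cmod (x / s - d) < 1" "s \<noteq> 0" for x s d
      proof -
        have "cmod (x / s) \<le> cmod d + 1"
          using norm_triangle_ineq2[of "x / s" d] that by linarith
        then show ?thesis using that by (simp add: norm_divide divide_simps)
      qed
      show ?thesis using gen[OF *(1)] gen[OF *(2)] that by simp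
    qed
    have "((\<lambda>h. beta2 (F (P (z + a + h) (w + h)))) \<longlongrightarrow> beta2 (F (P z w))) (at 0) \<and>
      ((\<lambda>h. beta1 (F (P (z + h) (w + a + h)))) \<longlongrightarrow> beta1 (F (P z w))) (at 0)"
      if a: "a \<noteq> 0" "cmod a < r" for a
    proof -
      define s where "s = min (cmod a) (r - cmod a)"
      have s: "s > 0" using a by (simp add: s_def)
      have small: "\<forall>\<^sub>F h in at (0::complex). a + h \<noteq> 0 \<and> cmod (a + h) < r \<and> h \<noteq> 0 \<and> cmod h < r"
        unfolding eventually_at
      proof (intro exI[of _ s] conjI s ballI impI)
        fix h :: complex assume h: "h \<noteq> 0 \<and> dist h 0 < s"
        show "a + h \<noteq> 0" using h by (auto simp: s_def add_eq_0_iff)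
        show "cmod (a + h) < r" using h norm_triangle_ineq[of a h] by (simp add: s_def)
        show "h \<noteq> 0" using h by simp
        show "cmod h < r" using h norm_ge_zero[of a] by (simp add: s_def del: norm_ge_zero)
      qed
      have l: "((\<lambda>h. c * cmod h) \<longlongrightarrow> 0) (at 0)" for c :: real
        by (auto intro!: tendsto_eq_intros)
      have 1: "((\<lambda>h. beta2 (F (P (z + a + h) (w + h))) - beta2 (F (P z w))) \<longlongrightarrow> 0) (at 0)"
      proof (rule Lim_null_comparison[OF _ l])
        show "\<forall>\<^sub>F h in at 0. cmod (beta2 (F (P (z + a + h) (w + h))) - beta2 (F (P z w)))
          \<le> (cmod d2 + 1) * cmod h"
          using small
        proof eventually_elim
          case (elim h)
          then show ?case using bound[of "a + h" h] by (simp add: add.assoc)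
        qed
      qed
      have 2: "((\<lambda>h. beta1 (F (P (z + h) (w + a + h))) - beta1 (F (P z w))) \<longlongrightarrow> 0) (at 0)"
      proof (rule Lim_null_comparison[OF _ l])
        show "\<forall>\<^sub>F h in at 0. cmod (beta1 (F (P (z + h) (w + a + h))) - beta1 (F (P z w)))
          \<le> (cmod d1 + 1) * cmod h"
          using small
        proof eventually_elim
          case (elim h)
          then show ?case using bound[of h "a + h"] by (simp add: add.assoc)
        qed
      qed
      show ?thesis using 1 2 Lim_null by blast
    qed
    then show ?thesis using r(1) by blast
  qed
  have diag: "((\<lambda>h. beta2 (F (P (z + h) (w + h)))) \<longlongrightarrow> beta2 (F (P z w))) (at 0) \<and>
      ((\<lambda>h. beta1 (F (P (z + h) (w + h)))) \<longlongrightarrow> beta1 (F (P z w))) (at 0) \<and>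
      (\<exists>d. ((\<lambda>h. (beta1 (F (P (z + h) (w + h))) - beta1 (F (P z w))) / h) \<longlongrightarrow> d) (at 0)) \<and>
      (\<exists>d. ((\<lambda>h. (beta2 (F (P (z + h) (w + h))) - beta2 (F (P z w))) / h) \<longlongrightarrow> d) (at 0))"
    if zw: "z \<in> H" "w \<in> H" for z w
  proof -
    obtain d1 d2 where
      d1: "((\<lambda>W. (beta1 (F W) - beta1 (F (P z w))) / (beta1 W - z)) \<longlongrightarrow> d1) (?A z w)" and
      d2: "((\<lambda>W. (beta2 (F W) - beta2 (F (P z w))) / (beta2 W - w)) \<longlongrightarrow> d2) (?A z w)"
      using lim[OF zw] by blast
    note t = tA[OF zw id0 id0 nz0]
    have q1: "((\<lambda>h. (beta1 (F (P (z + h) (w + h))) - beta1 (F (P z w))) / h) \<longlongrightarrow> d1) (at 0)"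
      using filterlim_compose[OF d1 t] by simp
    have q2: "((\<lambda>h. (beta2 (F (P (z + h) (w + h))) - beta2 (F (P z w))) / h) \<longlongrightarrow> d2) (at 0)"
      using filterlim_compose[OF d2 t] by simp
    have gen: "(f \<longlongrightarrow> L) (at 0)" if "((\<lambda>h. (f h - L) / h) \<longlongrightarrow> d) (at 0)"
      for f :: "complex \<Rightarrow> complex" and L d
    proof -
      have "((\<lambda>h. (f h - L) / h * h) \<longlongrightarrow> 0) (at 0)"
        using tendsto_mult[OF that id0] by simp
      then have "((\<lambda>h. f h - L) \<longlongrightarrow> 0) (at 0)"
        by (rule Lim_transform_eventually) (simp add: eventually_at_filter)
      then show ?thesis using Lim_null by blast
    qed
    show ?thesis using gen[OF q1] gen[OF q2] q1 q2 by blast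
  qed
  have const2: "beta2 (F (P z w)) = beta2 (F (P \<i> w))" if zw: "z \<in> H" "w \<in> H" for z w
  proof -
    have "((\<lambda>z. beta2 (F (P z w))) has_field_derivative 0) (at z within H)" if z: "z \<in> H" for z
    proof -
      obtain r1 where r1: "r1 > 0" "ball z r1 \<subseteq> H" using oH z openE by blast
      obtain r where r: "r > 0" and c: "\<And>a. a \<noteq> 0 \<Longrightarrow> cmod a < r \<Longrightarrow>
          ((\<lambda>h. beta2 (F (P (z + a + h) (w + h)))) \<longlongrightarrow> beta2 (F (P z w))) (at 0)"
        using cont[OF z zw(2)] by blast
      have "beta2 (F (P y w)) = beta2 (F (P z w))" if y: "y \<in> ball z (min r r1)" for y
      proof (cases "y = z")
        case False
        have "y \<in> H" using y r1 by auto
        then have "((\<lambda>h. beta2 (F (P (y + h) (w + h)))) \<longlongrightarrow> beta2 (F (P y w))) (at 0)"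
          using diag zw by blast
        moreover have "((\<lambda>h. beta2 (F (P (y + h) (w + h)))) \<longlongrightarrow> beta2 (F (P z w))) (at 0)"
          using c[of "y - z"] False y by (simp add: dist_norm norm_minus_commute)
        ultimately show ?thesis by (rule tendsto_unique[OF at_neq_bot])
      qed simp
      then have eq: "beta2 (F (P z w)) = beta2 (F (P y w))" if "y \<in> ball z (min r r1)" for y
        using that by metis
      have "((\<lambda>z. beta2 (F (P z w))) has_field_derivative 0) (at z)"
        by (rule has_field_derivative_transform_within_open
              [where S = "ball z (min r r1)", OF DERIV_const open_ball _ eq])
           (use r r1 in simp_all)
      then show ?thesis by (rule has_field_derivative_at_within)
    qed
    from has_field_derivative_zero_constant[OF cH this]
    obtain k where k: "\<forall>x\<in>H. beta2 (F (P x w)) = k" by blast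
    then show ?thesis using zw by (simp add: H_def)
  qed
  have const1: "beta1 (F (P z w)) = beta1 (F (P z \<i>))" if zw: "z \<in> H" "w \<in> H" for z w
  proof -
    have "((\<lambda>w. beta1 (F (P z w))) has_field_derivative 0) (at w within H)" if w: "w \<in> H" for w
    proof -
      obtain r1 where r1: "r1 > 0" "ball w r1 \<subseteq> H" using oH w openE by blast
      obtain r where r: "r > 0" and c: "\<And>a. a \<noteq> 0 \<Longrightarrow> cmod a < r \<Longrightarrow>
          ((\<lambda>h. beta1 (F (P (z + h) (w + a + h)))) \<longlongrightarrow> beta1 (F (P z w))) (at 0)"
        using cont[OF zw(1) w] by blast
      have "beta1 (F (P z y)) = beta1 (F (P z w))" if y: "y \<in> ball w (min r r1)" for y
      proof (cases "y = w")
        case False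
        have "y \<in> H" using y r1 by auto
        then have "((\<lambda>h. beta1 (F (P (z + h) (y + h)))) \<longlongrightarrow> beta1 (F (P z y))) (at 0)"
          using diag zw by blast
        moreover have "((\<lambda>h. beta1 (F (P (z + h) (y + h)))) \<longlongrightarrow> beta1 (F (P z w))) (at 0)"
          using c[of "y - w"] False y by (simp add: dist_norm norm_minus_commute)
        ultimately show ?thesis by (rule tendsto_unique[OF at_neq_bot])
      qed simp
      then have eq: "beta1 (F (P z w)) = beta1 (F (P z y))" if "y \<in> ball w (min r r1)" for y
        using that by metis
      have "((\<lambda>w. beta1 (F (P z w))) has_field_derivative 0) (at w)"
        by (rule has_field_derivative_transform_within_open
              [where S = "ball w (min r r1)", OF DERIV_const open_ball _ eq])
           (use r r1 in simp_all)
      then show ?thesis by (rule has_field_derivative_at_within)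
    qed
    from has_field_derivative_zero_constant[OF cH this]
    obtain k where k: "\<forall>x\<in>H. beta1 (F (P z x)) = k" by blast
    then show ?thesis using zw by (simp add: H_def)
  qed
  define F1 where "F1 z = beta1 (F (P z \<i>))" for z
  define F2 where "F2 w = beta2 (F (P \<i> w))" for w
  have iH: "\<i> \<in> H" by (simp add: H_def)
  have nearH: "\<forall>\<^sub>F h in at 0. z + h \<in> H" if "z \<in> H" for z
  proof -
    have "((\<lambda>h. z + h) \<longlongrightarrow> z + 0) (at 0)" by (intro tendsto_intros)
    then show ?thesis using oH that by (auto intro: topological_tendstoD)
  qed
  have "F1 field_differentiable (at z)" if z: "z \<in> H" for z
  proof -
    obtain d where "((\<lambda>h. (beta1 (F (P (z + h) (\<i> + h))) - beta1 (F (P z \<i>))) / h) \<longlongrightarrow> d) (at 0)"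
      using diag[OF z iH] by blast
    then have "((\<lambda>h. (F1 (z + h) - F1 z) / h) \<longlongrightarrow> d) (at 0)"
    proof (rule Lim_transform_eventually)
      show "\<forall>\<^sub>F h in at 0. (beta1 (F (P (z + h) (\<i> + h))) - beta1 (F (P z \<i>))) / h =
         (F1 (z + h) - F1 z) / h"
        using nearH[OF z] nearH[OF iH] by eventually_elim (simp add: F1_def const1)
    qed
    then show ?thesis unfolding field_differentiable_def DERIV_def by blast
  qed
  then have h1: "F1 holomorphic_on H"
    by (auto simp: holomorphic_on_def intro: field_differentiable_at_within)
  have "F2 field_differentiable (at z)" if z: "z \<in> H" for z
  proof -
    obtain d where "((\<lambda>h. (beta2 (F (P (\<i> + h) (z + h))) - beta2 (F (P \<i> z))) / h) \<longlongrightarrow> d) (at 0)"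
      using diag[OF iH z] by blast
    then have "((\<lambda>h. (F2 (z + h) - F2 z) / h) \<longlongrightarrow> d) (at 0)"
    proof (rule Lim_transform_eventually)
      show "\<forall>\<^sub>F h in at 0. (beta2 (F (P (\<i> + h) (z + h))) - beta2 (F (P \<i> z))) / h =
         (F2 (z + h) - F2 z) / h"
        using nearH[OF z] nearH[OF iH] by eventually_elim (simp add: F2_def const2)
    qed
    then show ?thesis unfolding field_differentiable_def DERIV_def by blast
  qed
  then have h2: "F2 holomorphic_on H"
    by (auto simp: holomorphic_on_def intro: field_differentiable_at_within)
  have "F (P z w) = P (F1 z) (F2 w)" if "z \<in> H" "w \<in> H" for z w
    using const1[OF that] const2[OF that] by (simp add: bicomplex_eq_iff_beta F1_def F2_def)
  with h1 h2 show ?thesis unfolding H_def P_def by blast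
qed

lemma decomp_imp_bc_holomorphic_on:
  assumes F1: "F1 holomorphic_on {z. Im z > 0}" and F2: "F2 holomorphic_on {z. Im z > 0}"
    and F: "\<And>z1 z2. Im z1 > 0 \<Longrightarrow> Im z2 > 0 \<Longrightarrow>
       F (bc_e * bc_of_complex z1 + bc_ed * bc_of_complex z2) =
         bc_e * bc_of_complex (F1 z1) + bc_ed * bc_of_complex (F2 z2)"
  shows "bc_holomorphic_on F bc_upper_half_plane"
  unfolding bc_holomorphic_on_def
proof
  fix Z assume Z: "Z \<in> bc_upper_half_plane"
  have FW: "beta1 (F W) = F1 (beta1 W)" "beta2 (F W) = F2 (beta2 W)"
    if "W \<in> bc_upper_half_plane" for W
    using F[of "beta1 W" "beta2 W"] that
    unfolding bicomplex_decomp[of W, symmetric] by (simp_all add: bc_upper_half_plane_def)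
  let ?A = "at Z within {W \<in> bc_upper_half_plane. (W - Z) dvd 1}"
  have "F1 field_differentiable at (beta1 Z)" "F2 field_differentiable at (beta2 Z)"
    using F1 F2 Z open_halfspace_Im_gt[of 0]
    by (auto simp: bc_upper_half_plane_def holomorphic_on_open field_differentiable_def)
  then obtain d1 d2 where
    "((\<lambda>z. (F1 z - F1 (beta1 Z)) / (z - beta1 Z)) \<longlongrightarrow> d1) (at (beta1 Z))"
    "((\<lambda>z. (F2 z - F2 (beta2 Z)) / (z - beta2 Z)) \<longlongrightarrow> d2) (at (beta2 Z))"
    by (auto simp: field_differentiable_def has_field_derivative_iff)
  moreover have "filterlim beta1 (at (beta1 Z)) ?A" "filterlim beta2 (at (beta2 Z)) ?A"
  proof -
    have "((\<lambda>W. W) \<longlongrightarrow> Z) ?A" by (rule tendsto_ident_at)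
    then have "(beta1 \<longlongrightarrow> beta1 Z) ?A" "(beta2 \<longlongrightarrow> beta2 Z) ?A"
      unfolding tendsto_bicomplex_iff by auto
    moreover have "\<forall>\<^sub>F W in ?A. beta1 W \<noteq> beta1 Z \<and> beta2 W \<noteq> beta2 Z"
      unfolding eventually_at_filter by (rule always_eventually) (auto simp: is_unit_bicomplex_iff)
    ultimately show "filterlim beta1 (at (beta1 Z)) ?A" "filterlim beta2 (at (beta2 Z)) ?A"
      by (auto simp: filterlim_at elim: eventually_mono)
  qed
  ultimately have q:
    "((\<lambda>W. (F1 (beta1 W) - F1 (beta1 Z)) / (beta1 W - beta1 Z)) \<longlongrightarrow> d1) ?A"
    "((\<lambda>W. (F2 (beta2 W) - F2 (beta2 Z)) / (beta2 W - beta2 Z)) \<longlongrightarrow> d2) ?A"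
    by (auto intro: filterlim_compose)
  have "((\<lambda>W. (beta1 (F W) - beta1 (F Z)) / (beta1 W - beta1 Z)) \<longlongrightarrow> d1) ?A"
    using q(1) by (rule Lim_transform_eventually)
      (auto simp: eventually_at_filter FW Z intro!: always_eventually)
  moreover have "((\<lambda>W. (beta2 (F W) - beta2 (F Z)) / (beta2 W - beta2 Z)) \<longlongrightarrow> d2) ?A"
    using q(2) by (rule Lim_transform_eventually)
      (auto simp: eventually_at_filter FW Z intro!: always_eventually)
  ultimately have "((\<lambda>W. (F W - F Z) / (W - Z)) \<longlongrightarrow> bc_e * bc_of_complex d1 + bc_ed * bc_of_complex d2) ?A"
    by (simp add: bc_quotient_within)
  then show "\<exists>D. ((\<lambda>W. (F W - F Z) / (W - Z)) \<longlongrightarrow> D) ?A" by blast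
qed

theorem bc_holomorphic_on_iff_decomp:
  "bc_holomorphic_on F bc_upper_half_plane \<longleftrightarrow>
    (\<exists>F1 F2. F1 holomorphic_on {z. Im z > 0} \<and> F2 holomorphic_on {z. Im z > 0} \<and>
      (\<forall>z1 z2. Im z1 > 0 \<longrightarrow> Im z2 > 0 \<longrightarrow>
         F (bc_e * bc_of_complex z1 + bc_ed * bc_of_complex z2) =
           bc_e * bc_of_complex (F1 z1) + bc_ed * bc_of_complex (F2 z2)))"
  using bc_holomorphic_on_imp_decomp decomp_imp_bc_holomorphic_on by blast


section \<open>Hyperbolic numbers\<close>

definition hyperbolic :: "bicomplex set" where
  "hyperbolic = {of_real a + bc_k * of_real b | a b. True}"

lemma hyperbolic_idempotent:
  "hyperbolic = {bc_e * of_real s1 + bc_ed * of_real s2 | s1 s2. True}"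
proof (intro equalityI subsetI)
  fix t assume "t \<in> hyperbolic"
  then obtain a b where "t = of_real a + bc_k * of_real b" by (auto simp: hyperbolic_def)
  then have "t = bc_e * of_real (a + b) + bc_ed * of_real (a - b)"
    by (simp add: bicomplex_eq_iff_beta)
  then show "t \<in> {bc_e * of_real s1 + bc_ed * of_real s2 | s1 s2. True}" by blast
next
  fix t assume "t \<in> {bc_e * of_real s1 + bc_ed * of_real s2 | s1 s2. True}"
  then obtain s1 s2 where "t = bc_e * of_real s1 + bc_ed * of_real s2" by blast
  then have "t = of_real ((s1 + s2) / 2) + bc_k * of_real ((s1 - s2) / 2)"
    by (simp add: bicomplex_eq_iff_beta field_simps)
  then show "t \<in> hyperbolic" unfolding hyperbolic_def by blast
qed

definition hyp_norm :: "bicomplex \<Rightarrow> bicomplex" where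
  "hyp_norm Z = bc_e * of_real (cmod (beta1 Z)) + bc_ed * of_real (cmod (beta2 Z))"

text \<open>Nonnegative hyperbolic numbers whose components may be infinite are represented by the pair
  of their idempotent components.  The order on pairs is the componentwise one, so that
  \<open>Sup\<close> is the supremum in the sense of the hyperbolic numbers.\<close>

type_synonym ehyperbolic = "ennreal \<times> ennreal"

text \<open>The order relation \<open>M < \<top>\<close> on pairs would only say that one of the components is finite.\<close>

definition ehyp_finite :: "ehyperbolic \<Rightarrow> bool" where
  "ehyp_finite M \<longleftrightarrow> fst M < \<infinity> \<and> snd M < \<infinity>"

definition ehyp_scale :: "real \<Rightarrow> ehyperbolic \<Rightarrow> ehyperbolic" where
  "ehyp_scale c M = (ennreal c * fst M, ennreal c * snd M)"


section \<open>Integrals over hyperbolic intervals\<close>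

text \<open>The integrals are meant for functions of product type,
  \<open>G (e s\<^sub>1 + e\<^sup>\<dagger> s\<^sub>2) = e G\<^sub>1(s\<^sub>1) + e\<^sup>\<dagger> G\<^sub>2(s\<^sub>2)\<close> for \<open>s\<^sub>1, s\<^sub>2 \<in> (a, b)\<close>.  The functions \<open>G\<^sub>1\<close>, \<open>G\<^sub>2\<close> are then
  the components of \<open>G\<close> on the diagonal \<open>e s + e\<^sup>\<dagger> s\<close>.  The first integral is complex in each
  component; the second is for \<open>G\<close> with nonnegative hyperbolic values and may be infinite.\<close>

definition D_integral :: "ereal \<Rightarrow> ereal \<Rightarrow> (bicomplex \<Rightarrow> bicomplex) \<Rightarrow> bicomplex" where
  "D_integral a b G =
     bc_e * bc_of_complex
       (LINT s:einterval a b|lborel. beta1 (G (bc_e * of_real s + bc_ed * of_real s))) +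
     bc_ed * bc_of_complex
       (LINT s:einterval a b|lborel. beta2 (G (bc_e * of_real s + bc_ed * of_real s)))"

definition D_nn_integral :: "ereal \<Rightarrow> ereal \<Rightarrow> (bicomplex \<Rightarrow> bicomplex) \<Rightarrow> ehyperbolic" where
  "D_nn_integral a b G =
     (\<integral>\<^sup>+s\<in>einterval a b. ennreal (Re (beta1 (G (bc_e * of_real s + bc_ed * of_real s)))) \<partial>lborel,
      \<integral>\<^sup>+s\<in>einterval a b. ennreal (Re (beta2 (G (bc_e * of_real s + bc_ed * of_real s)))) \<partial>lborel)"

lemma D_integral_product:
  assumes "\<And>s1 s2. s1 \<in> einterval a b \<Longrightarrow> s2 \<in> einterval a b \<Longrightarrow>
    G (bc_e * of_real s1 + bc_ed * of_real s2) =
      bc_e * bc_of_complex (G1 s1) + bc_ed * bc_of_complex (G2 s2)"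
  shows "D_integral a b G =
    bc_e * bc_of_complex (LINT s:einterval a b|lborel. G1 s) +
    bc_ed * bc_of_complex (LINT s:einterval a b|lborel. G2 s)"
proof -
  have "(LINT s:einterval a b|lborel. beta1 (G (bc_e * of_real s + bc_ed * of_real s))) =
      (LINT s:einterval a b|lborel. G1 s)"
    "(LINT s:einterval a b|lborel. beta2 (G (bc_e * of_real s + bc_ed * of_real s))) =
      (LINT s:einterval a b|lborel. G2 s)"
    by (rule set_lebesgue_integral_cong; simp add: assms)+
  then show ?thesis by (simp add: D_integral_def)
qed

lemma D_nn_integral_product:
  fixes G1 G2 :: "real \<Rightarrow> real"
  assumes "\<And>s1 s2. s1 \<in> einterval a b \<Longrightarrow> s2 \<in> einterval a b \<Longrightarrow>
    G (bc_e * of_real s1 + bc_ed * of_real s2) = bc_e * of_real (G1 s1) + bc_ed * of_real (G2 s2)"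
  shows "D_nn_integral a b G =
    (\<integral>\<^sup>+s\<in>einterval a b. ennreal (G1 s) \<partial>lborel, \<integral>\<^sup>+s\<in>einterval a b. ennreal (G2 s) \<partial>lborel)"
  unfolding D_nn_integral_def
  by (intro arg_cong2[where f = Pair] nn_integral_cong) (auto simp: assms split: split_indicator)

text \<open>Along the line determined by \<open>(x\<^sub>1, x\<^sub>2)\<close> the variable \<open>t\<close> of integration is hyperbolic: it
  absorbs \<open>x\<^sub>0 + k x\<^sub>3\<close>, and \<open>Z = t + i x\<^sub>1 + j x\<^sub>2\<close> stays in the upper half-plane.\<close>

lemma D_nn_integral_line:
  assumes F: "\<And>z1 z2. Im z1 > 0 \<Longrightarrow> Im z2 > 0 \<Longrightarrow>
       F (bc_e * bc_of_complex z1 + bc_ed * bc_of_complex z2) =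
         bc_e * bc_of_complex (F1 z1) + bc_ed * bc_of_complex (F2 z2)"
    and x: "x1 > \<bar>x2\<bar>"
  shows "D_nn_integral (-\<infinity>) \<infinity>
      (\<lambda>t. (hyp_norm (F (t + bc_i * of_real x1 + bc_j * of_real x2)))\<^sup>2) =
    (\<integral>\<^sup>+s. ennreal ((cmod (F1 (Complex s (x1 - x2))))\<^sup>2) \<partial>lborel,
     \<integral>\<^sup>+s. ennreal ((cmod (F2 (Complex s (x1 + x2))))\<^sup>2) \<partial>lborel)"
proof -
  have e: "einterval (-\<infinity>) \<infinity> = UNIV" by (auto simp: einterval_def)
  have "(hyp_norm (F (bc_e * of_real s1 + bc_ed * of_real s2
          + bc_i * of_real x1 + bc_j * of_real x2)))\<^sup>2 =
      bc_e * of_real ((cmod (F1 (Complex s1 (x1 - x2))))\<^sup>2) +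
      bc_ed * of_real ((cmod (F2 (Complex s2 (x1 + x2))))\<^sup>2)" for s1 s2
  proof -
    have eq: "bc_e * of_real s1 + bc_ed * of_real s2 + bc_i * of_real x1 + bc_j * of_real x2 =
       bc_e * bc_of_complex (Complex s1 (x1 - x2)) + bc_ed * bc_of_complex (Complex s2 (x1 + x2))"
      by (simp add: bicomplex_eq_iff_beta complex_eq_iff)
    have "F (bc_e * bc_of_complex (Complex s1 (x1 - x2)) +
            bc_ed * bc_of_complex (Complex s2 (x1 + x2))) =
        bc_e * bc_of_complex (F1 (Complex s1 (x1 - x2))) +
        bc_ed * bc_of_complex (F2 (Complex s2 (x1 + x2)))"
      using x by (intro F) auto
    then show ?thesis
      unfolding eq by (simp add: bicomplex_eq_iff_beta hyp_norm_def)
  qed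
  from D_nn_integral_product[of "-\<infinity>" \<infinity>
      "\<lambda>t. (hyp_norm (F (t + bc_i * of_real x1 + bc_j * of_real x2)))\<^sup>2"
      "\<lambda>s. (cmod (F1 (Complex s (x1 - x2))))\<^sup>2" "\<lambda>s. (cmod (F2 (Complex s (x1 + x2))))\<^sup>2", OF this]
  show ?thesis by (simp add: e)
qed

text \<open>\<open>L2\<close> consists of functions, not of classes modulo null sets; every class of functions
  square integrable for Lebesgue measure has a Borel representative.\<close>

definition L2 :: "(real \<Rightarrow> complex) set" where
  "L2 = {f. f \<in> borel_measurable lborel \<and> integrable lborel (\<lambda>s. (cmod (f s))\<^sup>2)}"

text \<open>Only the values of the function on the hyperbolic numbers matter.\<close>

definition L2_hyperbolic :: "(bicomplex \<Rightarrow> bicomplex) set" where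
  "L2_hyperbolic = {f. \<exists>f1\<in>L2. \<exists>f2\<in>L2. \<forall>s1 s2.
     f (bc_e * of_real s1 + bc_ed * of_real s2) =
       bc_e * bc_of_complex (f1 s1) + bc_ed * bc_of_complex (f2 s2)}"

end

theory Submission
  imports Defs "HOL-Probability.Sinc_Integral" "HOL-Complex_Analysis.Complex_Analysis"
    "HOL-Real_Asymp.Real_Asymp"
begin

text \<open>
  The idempotent decomposition reduces the claim to the scalar Paley-Wiener theorem for each
  component \<open>F\<close> on the complex upper half-plane, because \<open>x\<^sub>1 - x\<^sub>2\<close> and \<open>x\<^sub>1 + x\<^sub>2\<close> each range over all
  positive reals.  In the scalar case put \<open>G\<^sub>n(z) = F(z) / (1 - \<i> z / (n + 1))\<close>.  On every
  horizontal line \<open>G\<^sub>n\<close> is a product of two square integrable functions, with an L1 norm bounded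
  independently of the line.  For such functions contour shifts show that
  \<open>h\<^sub>n(t) = (2 \<pi>)\<^sup>-\<^sup>1 \<integral> G\<^sub>n(w) exp (- \<i> t w) dw\<close> is bounded and does not depend on the line of
  integration; Cauchy's formula and Fubini's theorem give
  \<open>G\<^sub>n(z) = \<integral>\<^sub>0\<^sup>\<infinity> h\<^sub>n(t) exp (\<i> t z) dt\<close> and Plancherel's identity with the weight \<open>exp (- 2 y t)\<close>
  on the line at height \<open>y\<close>.  Since \<open>G\<^sub>n\<close> tends to \<open>F\<close> in L2 on each line, the \<open>h\<^sub>n\<close> converge in all the
  weighted L2 spaces to a single \<open>f\<close>; letting \<open>y\<close> tend to \<open>0\<close> gives the norm of \<open>f\<close>.
\<close>

section \<open>Shifting horizontal lines of integration\<close>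

text \<open>A nonzero limit would keep \<open>norm (g x)\<close> above \<open>norm l / 2\<close> on
  a half-line, which has infinite measure. This replaces a pointwise decay estimate when the
  vertical sides of growing rectangles are discarded.\<close>

lemma integrable_tendsto_at_top_zero:
  fixes g :: "real \<Rightarrow> 'a::{banach, second_countable_topology}"
  assumes g: "integrable lborel g" and lim: "(g \<longlongrightarrow> l) at_top"
  shows "l = 0"
proof (rule ccontr)
  assume l: "l \<noteq> 0"
  have "\<forall>\<^sub>F x in at_top. norm l / 2 < norm (g x)"
    using order_tendstoD(1)[OF tendsto_norm[OF lim], of "norm l / 2"] l by simp
  then obtain N where N: "\<And>x. N \<le> x \<Longrightarrow> norm l / 2 < norm (g x)"
    by (auto simp: eventually_at_top_linorder)
  have "(\<integral>\<^sup>+x. ennreal (norm l / 2) * indicator {N..} x \<partial>lborel) \<le> (\<integral>\<^sup>+x. ennreal (norm (g x)) \<partial>lborel)"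
    using N by (intro nn_integral_mono) (auto split: split_indicator intro!: ennreal_leI less_imp_le)
  also have "\<dots> < \<infinity>"
    using g by (simp add: integrable_iff_bounded)
  finally have "ennreal (norm l / 2) * emeasure lborel {N..} < \<infinity>"
    by (simp add: nn_integral_cmult_indicator)
  moreover have "emeasure lborel {N..} = \<infinity>"
  proof -
    have "of_nat n \<le> emeasure lborel {N..}" for n
      using emeasure_mono[of "{N..N + real n}" "{N..}" lborel] by (simp add: ennreal_of_nat_eq_real_of_nat)
    then show ?thesis
      by (metis ennreal_Ex_less_of_nat infinity_ennreal_def leD not_top_less top.not_eq_extremum)
  qed
  ultimately show False
    using l by (simp add: ennreal_mult_top)
qed

lemma contour_integral_linepath_same_Im:
  assumes "Im z = c" "Im z' = c" "Re z = a" "Re z' = b" "a < b"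
  shows "contour_integral (linepath z z') f = integral {a..b} (\<lambda>x. f (Complex x c))"
proof -
  have z: "z = of_real a + \<i> * of_real c" "z' = of_real b + \<i> * of_real c"
    using assms by (auto simp: complex_eq_iff)
  have "contour_integral (linepath z z') f =
      contour_integral (linepath (of_real a) (of_real b)) (\<lambda>w. f (w + \<i> * of_real c))"
    by (simp add: contour_integral_integral z linepath_def algebra_simps scaleR_conv_of_real)
  also have "\<dots> = integral {a..b} (\<lambda>x. f (Complex x c))"
    using \<open>a < b\<close> by (simp add: contour_integral_linepath_Reals_eq Complex_eq)
  finally show ?thesis .
qed

text \<open>The path runs counterclockwise: bottom and right sides enter with a plus, top and left
  sides with a minus, and the vertical sides carry the factor \<open>\<i>\<close> from
  \<open>dz = \<i> dy\<close>. Continuity is asked on the boundary only, so a pole inside is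
  allowed.\<close>

lemma contour_integral_rectpath:
  assumes X: "X1 < X2" and ab: "a < b"
    and cont: "continuous_on (path_image (rectpath (Complex X1 a) (Complex X2 b))) f"
  shows "contour_integral (rectpath (Complex X1 a) (Complex X2 b)) f =
    (LINT x:{X1..X2}|lborel. f (Complex x a)) - (LINT x:{X1..X2}|lborel. f (Complex x b)) +
    \<i> * ((LINT y:{a..b}|lborel. f (Complex X2 y)) - (LINT y:{a..b}|lborel. f (Complex X1 y)))"
proof -
  let ?P = "path_image (rectpath (Complex X1 a) (Complex X2 b))"
  have P: "?P = {z. Re z \<in> {X1, X2} \<and> Im z \<in> {a..b}} \<union> {z. Im z \<in> {a, b} \<and> Re z \<in> {X1..X2}}"
    using X ab by (subst path_image_rectpath) auto
  have seg: "closed_segment (Complex X1 a) (Complex X2 a) \<subseteq> ?P"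
    "closed_segment (Complex X2 a) (Complex X2 b) \<subseteq> ?P"
    "closed_segment (Complex X2 b) (Complex X1 b) \<subseteq> ?P"
    "closed_segment (Complex X1 b) (Complex X1 a) \<subseteq> ?P"
    using X ab unfolding P
    by (auto simp: closed_segment_same_Re closed_segment_same_Im closed_segment_eq_real_ivl)
  have ci: "f contour_integrable_on linepath (Complex X1 a) (Complex X2 a)"
    "f contour_integrable_on linepath (Complex X2 a) (Complex X2 b)"
    "f contour_integrable_on linepath (Complex X2 b) (Complex X1 b)"
    "f contour_integrable_on linepath (Complex X1 b) (Complex X1 a)"
    using seg by (auto intro!: contour_integrable_continuous_linepath continuous_on_subset[OF cont])
  have 1: "contour_integral (rectpath (Complex X1 a) (Complex X2 b)) f =
    contour_integral (linepath (Complex X1 a) (Complex X2 a)) f +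
    contour_integral (linepath (Complex X2 a) (Complex X2 b)) f +
    contour_integral (linepath (Complex X2 b) (Complex X1 b)) f +
    contour_integral (linepath (Complex X1 b) (Complex X1 a)) f"
    using ci by (simp add: rectpath_def Let_def)
  have h: "(LINT x:{X1..X2}|lborel. f (Complex x c)) = integral {X1..X2} (\<lambda>x. f (Complex x c))"
    if "c = a \<or> c = b" for c
  proof (rule set_borel_integral_eq_integral(2))
    have "continuous_on {X1..X2} (\<lambda>x. f (Complex x c))"
      using that ab by (intro continuous_on_compose2[OF cont])
       (auto simp: P intro!: continuous_intros)
    then show "set_integrable lborel {X1..X2} (\<lambda>x. f (Complex x c))"
      by (rule borel_integrable_atLeastAtMost')
  qed
  have v: "(LINT y:{a..b}|lborel. f (Complex X y)) = integral {a..b} (\<lambda>y. f (Complex X y))"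
    if "X = X1 \<or> X = X2" for X
  proof (rule set_borel_integral_eq_integral(2))
    have "continuous_on {a..b} (\<lambda>y. f (Complex X y))"
      using that X by (intro continuous_on_compose2[OF cont])
       (auto simp: P intro!: continuous_intros)
    then show "set_integrable lborel {a..b} (\<lambda>y. f (Complex X y))"
      by (rule borel_integrable_atLeastAtMost')
  qed
  have "contour_integral (linepath (Complex X1 a) (Complex X2 a)) f = (LINT x:{X1..X2}|lborel. f (Complex x a))"
    using X by (simp add: h contour_integral_linepath_same_Im)
  moreover have "contour_integral (linepath (Complex X2 b) (Complex X1 b)) f = - (LINT x:{X1..X2}|lborel. f (Complex x b))"
    using X contour_integral_linepath_same_Im[of "Complex X1 b" b "Complex X2 b" X1 X2 f]
      contour_integral_reverse_linepath[of "Complex X1 b" "Complex X2 b" f]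
      continuous_on_subset[OF cont seg(3)]
    by (simp add: h closed_segment_commute)
  moreover have "contour_integral (linepath (Complex X2 a) (Complex X2 b)) f = \<i> * (LINT y:{a..b}|lborel. f (Complex X2 y))"
    using ab by (simp add: v contour_integral_linepath_same_Re[where a=a and b=b and c=X2])
  moreover have "contour_integral (linepath (Complex X1 b) (Complex X1 a)) f = - \<i> * (LINT y:{a..b}|lborel. f (Complex X1 y))"
    using ab contour_integral_linepath_same_Re[of "Complex X1 a" X1 "Complex X1 b" a b f]
      contour_integral_reverse_linepath[of "Complex X1 a" "Complex X1 b" f]
      continuous_on_subset[OF cont seg(4)]
    by (simp add: v closed_segment_commute)
  ultimately show ?thesis
    unfolding 1 by (simp add: algebra_simps)
qed


lemma borel_measurable_Complex [measurable (raw)]: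
  assumes [measurable]: "f \<in> borel_measurable M" "g \<in> borel_measurable M"
  shows "(\<lambda>x. Complex (f x) (g x)) \<in> borel_measurable M"
  unfolding Complex_eq by measurable

text \<open>The vertical sides of the rectangle have integrable total contribution as a function of \<open>X\<close>,
  and the horizontal sides converge as \<open>X\<close> tends to infinity; so the contribution of the vertical
  sides converges as well, necessarily to \<open>0\<close>.\<close>

lemma line_integral_difference:
  assumes ab: "a < b" and R: "R > 0"
    and int: "integrable lborel (\<lambda>x. K (Complex x a))" "integrable lborel (\<lambda>x. K (Complex x b))"
    and cont: "continuous_on {w. a \<le> Im w \<and> Im w \<le> b \<and> (Im w = a \<or> Im w = b \<or> R \<le> \<bar>Re w\<bar>)} K"
    and rect: "\<And>X. X \<ge> R \<Longrightarrow> contour_integral (rectpath (Complex (- X) a) (Complex X b)) K = c"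
    and strip: "\<And>y. a \<le> y \<Longrightarrow> y \<le> b \<Longrightarrow>
      (\<integral>\<^sup>+x. ennreal (cmod (K (Complex x y))) * indicator {x. R \<le> \<bar>x\<bar>} x \<partial>lborel) \<le> ennreal B"
  shows "(LINT x|lborel. K (Complex x a)) - (LINT x|lborel. K (Complex x b)) = c"
proof -
  define S where "S = {w. a \<le> Im w \<and> Im w \<le> b \<and> R \<le> \<bar>Re w\<bar>}"
  \<comment> \<open>\<open>K\<close> may have a pole in the middle of the strip, so it is cut off to
    \<open>R \<le> \<bar>Re w\<bar>\<close> before Fubini's theorem is applied.\<close>
  define L where "L w = indicator S w *\<^sub>R K w" for w
  have S: "closed S"
    unfolding S_def by (intro closed_Collect_conj closed_Collect_le continuous_intros)
  have [measurable]: "L \<in> borel_measurable borel"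
    unfolding L_def using S
    by (intro borel_measurable_continuous_on_indicator)
       (auto simp: S_def intro: continuous_on_subset[OF cont])
  have intL: "integrable (lborel \<Otimes>\<^sub>M lborel) (\<lambda>(x, y). L (Complex x y))"
    unfolding integrable_iff_bounded
  proof
    have "(\<integral>\<^sup>+p. ennreal (norm (case p of (x, y) \<Rightarrow> L (Complex x y))) \<partial>(lborel \<Otimes>\<^sub>M lborel)) =
        (\<integral>\<^sup>+y. \<integral>\<^sup>+x. ennreal (norm (L (Complex x y))) \<partial>lborel \<partial>lborel)"
      by (subst lborel_pair.nn_integral_snd[symmetric]) auto
    also have "\<dots> \<le> (\<integral>\<^sup>+y. ennreal B * indicator {a..b} y \<partial>lborel)"
    proof (rule nn_integral_mono)
      fix y
      show "(\<integral>\<^sup>+x. ennreal (norm (L (Complex x y))) \<partial>lborel) \<le> ennreal B * indicator {a..b} y"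
      proof (cases "y \<in> {a..b}")
        case True
        then have "(\<integral>\<^sup>+x. ennreal (norm (L (Complex x y))) \<partial>lborel) =
          (\<integral>\<^sup>+x. ennreal (cmod (K (Complex x y))) * indicator {x. R \<le> \<bar>x\<bar>} x \<partial>lborel)"
          by (intro nn_integral_cong) (auto simp: L_def S_def split: split_indicator)
        then show ?thesis using True strip[of y] by simp
      next
        case False
        then have "L (Complex x y) = 0" for x by (auto simp: L_def S_def)
        then show ?thesis using False by simp
      qed
    qed
    also have "\<dots> < \<infinity>"
      using ab by (simp add: nn_integral_cmult_indicator ennreal_mult_less_top)
    finally show "(\<integral>\<^sup>+p. ennreal (norm (case p of (x, y) \<Rightarrow> L (Complex x y))) \<partial>(lborel \<Otimes>\<^sub>M lborel)) < \<infinity>" .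
  qed measurable
  \<comment> \<open>For \<open>R \<le> \<bar>x\<bar>\<close> this is the integral over the vertical
    side at abscissa \<open>x\<close>. The bound \<open>strip\<close>, integrated over the heights
    in \<open>{a..b}\<close>, makes it integrable in \<open>x\<close>.\<close>
  define W where "W x = (LINT y|lborel. L (Complex x y))" for x
  have W: "integrable lborel W"
    unfolding W_def using lborel_pair.integrable_fst[OF intL] .
  have "integrable lborel (\<lambda>x. W (0 + (-1) * x))"
    by (rule lborel_integrable_real_affine[OF W]) simp
  then have "integrable lborel (\<lambda>x. \<i> * (W x - W (- x)))"
    using W by simp
  \<comment> \<open>For \<open>X \<ge> R\<close> the rectangle identity expresses the vertical sides
    as \<open>c\<close> minus the difference of the truncated horizontal integrals, and these
    converge by dominated convergence.\<close>
  moreover have "((\<lambda>x. \<i> * (W x - W (- x))) \<longlongrightarrow>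
      c - ((LINT x|lborel. K (Complex x a)) - (LINT x|lborel. K (Complex x b)))) at_top"
  proof (rule Lim_transform_eventually)
    show "((\<lambda>X. c - ((LINT x:{-X..X}|lborel. K (Complex x a)) - (LINT x:{-X..X}|lborel. K (Complex x b)))) \<longlongrightarrow>
      c - ((LINT x|lborel. K (Complex x a)) - (LINT x|lborel. K (Complex x b)))) at_top"
    proof (intro tendsto_intros)
      have *: "((\<lambda>X. LINT x:{-X..X}|lborel. g x) \<longlongrightarrow> (LINT x|lborel. g x)) at_top"
        if g: "integrable lborel g" for g :: "real \<Rightarrow> complex"
        unfolding set_lebesgue_integral_def
      proof (rule integral_dominated_convergence_at_top[where w = "\<lambda>x. norm (g x)"])
        show "AE x in lborel. ((\<lambda>X. indicator {-X..X} x *\<^sub>R g x) \<longlongrightarrow> g x) at_top"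
        proof (intro AE_I2 tendsto_eventually)
          fix x :: real
          show "\<forall>\<^sub>F X in at_top. indicator {-X..X} x *\<^sub>R g x = g x"
            using eventually_ge_at_top[of "\<bar>x\<bar>"] by eventually_elim (auto simp: indicator_def)
        qed
      qed (use g in \<open>auto split: split_indicator intro!: always_eventually\<close>)
      show "((\<lambda>X. LINT x:{-X..X}|lborel. K (Complex x a)) \<longlongrightarrow> (LINT x|lborel. K (Complex x a))) at_top"
        "((\<lambda>X. LINT x:{-X..X}|lborel. K (Complex x b)) \<longlongrightarrow> (LINT x|lborel. K (Complex x b))) at_top"
        using int by (auto intro!: *)
    qed
    show "\<forall>\<^sub>F X in at_top. c - ((LINT x:{-X..X}|lborel. K (Complex x a)) - (LINT x:{-X..X}|lborel. K (Complex x b)))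
        = \<i> * (W X - W (- X))"
      using eventually_ge_at_top[of R]
    proof eventually_elim
      fix X assume X: "R \<le> X"
      have w: "W x = (LINT y:{a..b}|lborel. K (Complex x y))" if "R \<le> \<bar>x\<bar>" for x
        unfolding W_def set_lebesgue_integral_def using that
        by (intro Bochner_Integration.integral_cong) (auto simp: L_def S_def split: split_indicator)
      have "contour_integral (rectpath (Complex (-X) a) (Complex X b)) K =
        (LINT x:{-X..X}|lborel. K (Complex x a)) - (LINT x:{-X..X}|lborel. K (Complex x b)) +
        \<i> * ((LINT y:{a..b}|lborel. K (Complex X y)) - (LINT y:{a..b}|lborel. K (Complex (-X) y)))"
        using X R ab
        by (intro contour_integral_rectpath continuous_on_subset[OF cont])
           (auto simp: path_image_rectpath)
      then show "c - ((LINT x:{-X..X}|lborel. K (Complex x a)) - (LINT x:{-X..X}|lborel. K (Complex x b)))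
        = \<i> * (W X - W (- X))"
        using rect[OF X] w[of X] w[of "- X"] X by simp
    qed
  qed
  ultimately have "c - ((LINT x|lborel. K (Complex x a)) - (LINT x|lborel. K (Complex x b))) = 0"
    by (rule integrable_tendsto_at_top_zero)
  then show ?thesis by simp
qed

section \<open>Functions with bounded L1 norms on horizontal lines\<close>

lemma integrable_exp_scale_Ioi:
  fixes s :: complex
  assumes s: "Re s > 0"
  shows "set_integrable lborel {0<..} (\<lambda>t. exp (- (s * of_real t)))"
proof -
  have "set_integrable lborel {0<..} (\<lambda>t. exp (-(t * Re s)))"
    using s by (rule integrable_I0i_exp_mscale)
  then show ?thesis
    unfolding set_integrable_def
    by (rule Bochner_Integration.integrable_bound) (auto simp: mult_ac split: split_indicator)
qed

text \<open>The antiderivative \<open>- exp (- (s * t)) / s\<close> vanishes at infinity because its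
  modulus decays like \<open>exp (- (Re s * t))\<close>. The parameter is complex so that the
  formula can produce the Cauchy kernel in \<open>inversion\<close>.\<close>

lemma LINT_exp_scale_Ioi:
  fixes s :: complex
  assumes s: "Re s > 0"
  shows "(LINT t:{0<..}|lborel. exp (- (s * of_real t))) = 1 / s"
proof -
  have "(LBINT t=0..\<infinity>. exp (- (s * of_real t))) = 0 - (- (1 / s))"
  proof (rule interval_integral_FTC_integrable)
    show "((\<lambda>t. - (exp (- (s * of_real t)) / s)) has_vector_derivative exp (- (s * of_real t))) (at t)"
      for t using s by (auto intro!: derivative_eq_intros has_vector_derivative_real_field)
    show "set_integrable lborel (einterval 0 \<infinity>) (\<lambda>t. exp (- (s * of_real t)))"
      using integrable_exp_scale_Ioi[OF s] by (simp add: einterval_def greaterThan_def)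
    have "((\<lambda>t. - (exp (- (s * of_real t)) / s)) \<longlongrightarrow> - (exp (- (s * of_real 0)) / s)) (at_right 0)"
      using s by (intro tendsto_intros) auto
    then show "(((\<lambda>t. - (exp (- (s * of_real t)) / s)) \<circ> real_of_ereal) \<longlongrightarrow> - (1 / s)) (at_right 0)"
      by (simp add: zero_ereal_def ereal_tendsto_simps)
    have "((\<lambda>t. norm (exp (- (s * of_real t)))) \<longlongrightarrow> 0) at_top"
    proof -
      have "((\<lambda>t. exp (- (Re s * t))) \<longlongrightarrow> 0) at_top"
        using s by real_asymp
      then show ?thesis by simp
    qed
    then have "((\<lambda>t. - (exp (- (s * of_real t)) / s)) \<longlongrightarrow> - (0 / s)) at_top"
      unfolding tendsto_norm_zero_iff using s by (intro tendsto_intros) auto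
    then show "(((\<lambda>t. - (exp (- (s * of_real t)) / s)) \<circ> real_of_ereal) \<longlongrightarrow> 0) (at_left \<infinity>)"
      by (simp add: ereal_tendsto_simps)
  qed auto
  then show ?thesis
    by (simp add: interval_lebesgue_integral_0_infty)
qed

text \<open>Tonelli's theorem factors the integral of the majorant into two finite ones. This
  supplies the hypothesis of Fubini's theorem in \<open>inversion\<close> and
  \<open>plancherel\<close>.\<close>

lemma integrable_pair_bound:
  fixes P :: "'a \<times> 'b \<Rightarrow> 'c::{banach, second_countable_topology}" and f :: "'a \<Rightarrow> real" and g :: "'b \<Rightarrow> real"
  assumes "sigma_finite_measure M" "sigma_finite_measure N"
    and P [measurable]: "P \<in> borel_measurable (M \<Otimes>\<^sub>M N)"
    and f: "integrable M f" and g: "integrable N g"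
    and b: "\<And>x t. norm (P (x, t)) \<le> f x * g t" and nn: "\<And>x. 0 \<le> f x" "\<And>t. 0 \<le> g t"
  shows "integrable (M \<Otimes>\<^sub>M N) P"
  unfolding integrable_iff_bounded
proof
  interpret M: sigma_finite_measure M by fact
  interpret N: sigma_finite_measure N by fact
  note [measurable] = borel_measurable_integrable[OF f] borel_measurable_integrable[OF g]
  have fin: "(\<integral>\<^sup>+x. ennreal (f x) \<partial>M) < \<infinity>" "(\<integral>\<^sup>+t. ennreal (g t) \<partial>N) < \<infinity>"
    using f g nn by (simp_all add: integrable_iff_bounded)
  have "(\<integral>\<^sup>+p. ennreal (norm (P p)) \<partial>(M \<Otimes>\<^sub>M N)) = (\<integral>\<^sup>+x. \<integral>\<^sup>+t. ennreal (norm (P (x, t))) \<partial>N \<partial>M)"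
    by (rule N.nn_integral_fst[symmetric]) measurable
  also have "\<dots> \<le> (\<integral>\<^sup>+x. \<integral>\<^sup>+t. ennreal (f x) * ennreal (g t) \<partial>N \<partial>M)"
    using b nn by (intro nn_integral_mono) (simp add: ennreal_mult[symmetric] ennreal_leI)
  also have "\<dots> = (\<integral>\<^sup>+x. ennreal (f x) \<partial>M) * (\<integral>\<^sup>+t. ennreal (g t) \<partial>N)"
    by (simp add: nn_integral_cmult nn_integral_multc)
  also have "\<dots> < \<infinity>" using fin by (simp add: ennreal_mult_less_top)
  finally show "(\<integral>\<^sup>+p. ennreal (norm (P p)) \<partial>(M \<Otimes>\<^sub>M N)) < \<infinity>" .
qed measurable

lemma continuous_on_horizontal_line:
  assumes "F holomorphic_on {z. 0 < Im z}" "0 < y"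
  shows "continuous_on UNIV (\<lambda>x. F (Complex x y))"
  using assms by (intro continuous_on_compose2[OF holomorphic_on_imp_continuous_on[OF assms(1)]])
    (auto intro!: continuous_intros)

text \<open>The height \<open>1\<close> is an arbitrary choice; see \<open>transform_line\<close> below.\<close>

definition half_plane_transform :: "(complex \<Rightarrow> complex) \<Rightarrow> real \<Rightarrow> complex" where
  "half_plane_transform G t =
     (LINT x|lborel. G (Complex x 1) * exp (- (\<i> * of_real t * Complex x 1))) / of_real (2 * pi)"

text \<open>The Hardy space H1 of the upper half-plane, with \<open>C\<close> any upper bound for
  the norm. For such functions the Fourier integrals along horizontal lines converge
  absolutely.\<close>

locale hardy_one =
  fixes G :: "complex \<Rightarrow> complex" and C :: real
  assumes holomorphic: "G holomorphic_on {z. 0 < Im z}"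
    and C_nonneg: "0 \<le> C"
    and bound: "0 < y \<Longrightarrow> (\<integral>\<^sup>+x. ennreal (cmod (G (Complex x y))) \<partial>lborel) \<le> ennreal C"
begin

section \<open>Estimates along one horizontal line\<close>

lemma continuous_line: "0 < y \<Longrightarrow> continuous_on UNIV (\<lambda>x. G (Complex x y))"
  by (rule continuous_on_horizontal_line[OF holomorphic])

lemma measurable_line: "0 < y \<Longrightarrow> (\<lambda>x. G (Complex x y)) \<in> borel_measurable borel"
  by (intro borel_measurable_continuous_onI continuous_line)

lemma integrable_line: "0 < y \<Longrightarrow> integrable lborel (\<lambda>x. G (Complex x y))"
  unfolding integrable_iff_bounded using bound[of y] measurable_line[of y]
  by (auto intro: le_less_trans)

lemma integral_norm_line_le: "0 < y \<Longrightarrow> (LINT x|lborel. cmod (G (Complex x y))) \<le> C"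
  using bound[of y] integrable_norm[OF integrable_line[of y]] C_nonneg
  by (simp add: nn_integral_eq_integral)

lemma integrable_line_mult:
  assumes y: "0 < y" and k [measurable]: "k \<in> borel_measurable borel" and B: "\<And>x. cmod (k x) \<le> B"
  shows "integrable lborel (\<lambda>x. G (Complex x y) * k x)"
proof (rule Bochner_Integration.integrable_bound)
  show "integrable lborel (\<lambda>x. B *\<^sub>R G (Complex x y))"
    using integrable_line[OF y] by simp
  show "AE x in lborel. norm (G (Complex x y) * k x) \<le> norm (B *\<^sub>R G (Complex x y))"
  proof (intro AE_I2)
    fix x
    have "cmod (k x) \<le> \<bar>B\<bar>" using B[of x] by linarith
    then show "norm (G (Complex x y) * k x) \<le> norm (B *\<^sub>R G (Complex x y))"
      by (simp add: norm_mult mult.commute[of "cmod (G _)"] mult_right_mono)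
  qed
qed (use measurable_line[OF y] in measurable)

lemma norm_integral_line_mult_le:
  assumes y: "0 < y" and k [measurable]: "k \<in> borel_measurable borel" and B: "\<And>x. cmod (k x) \<le> B"
  shows "cmod (LINT x|lborel. G (Complex x y) * k x) \<le> C * B"
proof -
  have B0: "0 \<le> B" using B[of 0] norm_ge_zero order_trans by blast
  have "cmod (LINT x|lborel. G (Complex x y) * k x) \<le> (LINT x|lborel. cmod (G (Complex x y)) * B)"
    using integrable_line_mult[OF assms] integrable_line[OF y] B
    by (intro Bochner_Integration.integral_norm_bound_integral) (auto simp: norm_mult intro: mult_left_mono)
  also have "\<dots> \<le> C * B"
    using integral_norm_line_le[OF y] B0 by (simp add: mult_right_mono)
  finally show ?thesis .
qed

text \<open>Verifies the assumption \<open>strip\<close> of \<open>line_integral_difference\<close>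
  for kernels dominated by a multiple of \<open>G\<close>; \<open>A\<close> is the part of the line
  that stays away from a possible pole.\<close>

lemma strip_bound:
  assumes y: "0 < y" and B: "\<And>x. x \<in> A \<Longrightarrow> cmod (K (Complex x y)) \<le> B * cmod (G (Complex x y))" and "0 \<le> B"
  shows "(\<integral>\<^sup>+x. ennreal (cmod (K (Complex x y))) * indicator A x \<partial>lborel) \<le> ennreal (B * C)"
proof -
  have "(\<integral>\<^sup>+x. ennreal (cmod (K (Complex x y))) * indicator A x \<partial>lborel) \<le>
      (\<integral>\<^sup>+x. ennreal B * ennreal (cmod (G (Complex x y))) \<partial>lborel)"
    using assms by (intro nn_integral_mono)
      (auto split: split_indicator simp: ennreal_mult[symmetric] intro: ennreal_leI)
  also have "\<dots> \<le> ennreal B * ennreal C"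
    using measurable_line[OF y] bound[OF y] by (subst nn_integral_cmult) (auto intro: mult_left_mono)
  finally show ?thesis using assms C_nonneg by (simp add: ennreal_mult)
qed

text \<open>The integrand is \<open>G\<close> times an entire function, so its integral over every
  rectangle vanishes by Cauchy's theorem. Between the two lines the exponential has modulus
  \<open>exp (t * y)\<close>, at most \<open>exp (\<bar>t\<bar> * b)\<close>, which gives the strip
  bound.\<close>

lemma transform_shift:
  assumes ab: "0 < a" "a < b"
  shows "(LINT x|lborel. G (Complex x a) * exp (- (\<i> * of_real t * Complex x a))) =
    (LINT x|lborel. G (Complex x b) * exp (- (\<i> * of_real t * Complex x b)))"
proof -
  define K where "K w = G w * exp (- (\<i> * of_real t * w))" for w
  have K: "K holomorphic_on {z. 0 < Im z}"
    unfolding K_def by (intro holomorphic_intros holomorphic)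
  have int: "integrable lborel (\<lambda>x. K (Complex x y))" if "0 < y" for y
    unfolding K_def using that by (intro integrable_line_mult[where B = "exp (t * y)"]) auto
  have "(LINT x|lborel. K (Complex x a)) - (LINT x|lborel. K (Complex x b)) = 0"
  proof (rule line_integral_difference[where R = 1])
    show "continuous_on {w. a \<le> Im w \<and> Im w \<le> b \<and> (Im w = a \<or> Im w = b \<or> 1 \<le> \<bar>Re w\<bar>)} K"
      using ab by (intro continuous_on_subset[OF holomorphic_on_imp_continuous_on[OF K]]) auto
    show "contour_integral (rectpath (Complex (- X) a) (Complex X b)) K = 0" if "1 \<le> X" for X
      using that ab
      by (intro contour_integral_unique Cauchy_theorem_convex_simple[OF K] convex_halfspace_Im_gt)
         (auto simp: path_image_rectpath)
    show "(\<integral>\<^sup>+x. ennreal (cmod (K (Complex x y))) * indicator {x. 1 \<le> \<bar>x\<bar>} x \<partial>lborel)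
        \<le> ennreal (exp (\<bar>t\<bar> * b) * C)" if "a \<le> y" "y \<le> b" for y
    proof (rule strip_bound)
      have "exp (t * y) \<le> exp (\<bar>t\<bar> * b)" using that ab by (auto intro!: mult_mono)
      then show "cmod (K (Complex x y)) \<le> exp (\<bar>t\<bar> * b) * cmod (G (Complex x y))" for x
        unfolding K_def by (simp add: norm_mult mult.commute[of "cmod (G _)"] mult_right_mono)
    qed (use that ab in auto)
  qed (use ab int in auto)
  then show ?thesis by (simp add: K_def)
qed

lemma transform_line:
  assumes y: "0 < y"
  shows "half_plane_transform G t =
    (LINT x|lborel. G (Complex x y) * exp (- (\<i> * of_real t * Complex x y))) / of_real (2 * pi)"
  unfolding half_plane_transform_def
proof (cases y "1::real" rule: linorder_cases)
  case less
  show "(LINT x|lborel. G (Complex x 1) * exp (- (\<i> * of_real t * Complex x 1))) / of_real (2 * pi) =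
    (LINT x|lborel. G (Complex x y) * exp (- (\<i> * of_real t * Complex x y))) / of_real (2 * pi)"
    by (simp only: transform_shift[OF y less])
next
  case greater
  show "(LINT x|lborel. G (Complex x 1) * exp (- (\<i> * of_real t * Complex x 1))) / of_real (2 * pi) =
    (LINT x|lborel. G (Complex x y) * exp (- (\<i> * of_real t * Complex x y))) / of_real (2 * pi)"
    by (simp only: transform_shift[OF zero_less_one greater])
qed (simp only:)

lemma norm_transform_le_exp:
  assumes y: "0 < y"
  shows "cmod (half_plane_transform G t) \<le> C / (2 * pi) * exp (t * y)"
  unfolding transform_line[OF y]
  using norm_integral_line_mult_le[OF y, of "\<lambda>x. exp (- (\<i> * of_real t * Complex x y))" "exp (t * y)"]
  by (simp add: norm_divide divide_right_mono)

text \<open>The transform does not depend on the height \<open>y\<close>, so \<open>y\<close> may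
  tend to \<open>0\<close> in the preceding bound, where the factor \<open>exp (t * y)\<close> tends
  to \<open>1\<close>.\<close>

lemma norm_transform_le: "cmod (half_plane_transform G t) \<le> C / (2 * pi)"
proof (rule tendsto_lowerbound)
  show "((\<lambda>y. C / (2 * pi) * exp (t * y)) \<longlongrightarrow> C / (2 * pi)) (at_right 0)"
    by (auto intro!: tendsto_eq_intros)
  show "\<forall>\<^sub>F y in at_right 0. cmod (half_plane_transform G t) \<le> C / (2 * pi) * exp (t * y)"
    using norm_transform_le_exp by (auto simp: eventually_at_filter)
qed simp

lemma transform_measurable [measurable]: "half_plane_transform G \<in> borel_measurable borel"
proof -
  have [measurable]: "(\<lambda>x. G (Complex x 1)) \<in> borel_measurable borel"
    by (rule measurable_line) simp
  have "half_plane_transform G \<in> borel_measurable lborel"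
    unfolding half_plane_transform_def by measurable
  then show ?thesis by simp
qed

text \<open>The point \<open>z\<close> lies between the line at height \<open>a\<close> and any line
  at a height \<open>b > Im z\<close>; the two line integrals differ by the residue at
  \<open>z\<close>. The upper one is at most \<open>C / (b - Im z)\<close> and disappears as
  \<open>b\<close> grows.\<close>

lemma cauchy_formula:
  assumes a: "0 < a" "a < Im z"
  shows "(LINT x|lborel. G (Complex x a) / (Complex x a - z)) = 2 * pi * \<i> * G z"
proof -
  define K where "K w = G w / (w - z)" for w
  have K: "K holomorphic_on {w. 0 < Im w} - {z}"
    unfolding K_def by (intro holomorphic_intros holomorphic_on_subset[OF holomorphic]) auto
  have dist: "\<bar>y - Im z\<bar> \<le> cmod (Complex x y - z)" for x y
    using abs_Im_le_cmod[of "Complex x y - z"] by simp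
  have inv: "cmod (1 / (Complex x y - z)) \<le> 1 / \<bar>y - Im z\<bar>" if "y \<noteq> Im z" for x y
    using dist[of y x] that by (simp add: norm_divide frac_le)
  have eq: "K (Complex x y) = G (Complex x y) * (1 / (Complex x y - z))" for x y
    by (simp add: K_def)
  have int: "integrable lborel (\<lambda>x. K (Complex x y))" if "0 < y" "y \<noteq> Im z" for y
    unfolding eq using that inv by (intro integrable_line_mult) auto
  have diff: "(LINT x|lborel. K (Complex x a)) - (LINT x|lborel. K (Complex x b)) = 2 * pi * \<i> * G z"
    if b: "Im z < b" for b
  \<comment> \<open>This \<open>R\<close> puts \<open>z\<close> strictly inside every rectangle, and
    for \<open>R \<le> \<bar>Re w\<bar>\<close> the distance from \<open>w\<close> to
    \<open>z\<close> is at least \<open>1\<close>, so \<open>K\<close> is dominated there by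
    \<open>G\<close>.\<close>
  proof (rule line_integral_difference[where R = "\<bar>Re z\<bar> + 1"])
    show "continuous_on {w. a \<le> Im w \<and> Im w \<le> b \<and> (Im w = a \<or> Im w = b \<or> \<bar>Re z\<bar> + 1 \<le> \<bar>Re w\<bar>)} K"
      using a b by (intro continuous_on_subset[OF holomorphic_on_imp_continuous_on[OF K]]) auto
    show "contour_integral (rectpath (Complex (- X) a) (Complex X b)) K = 2 * pi * \<i> * G z"
      if X: "\<bar>Re z\<bar> + 1 \<le> X" for X
    proof -
      have "z \<in> box (Complex (- X) a) (Complex X b)"
        using X a b by (auto simp: in_box_complex_iff)
      then have "winding_number (rectpath (Complex (- X) a) (Complex X b)) z = 1"
        by (rule winding_number_rectpath)
      moreover have "((\<lambda>w. G w / (w - z)) has_contour_integral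
          2 * pi * \<i> * winding_number (rectpath (Complex (- X) a) (Complex X b)) z * G z)
          (rectpath (Complex (- X) a) (Complex X b))"
        using X a b open_halfspace_Im_gt[of 0]
        by (intro Cauchy_integral_formula_convex_simple[OF _ holomorphic] convex_halfspace_Im_gt)
           (auto simp: path_image_rectpath interior_open)
      ultimately show ?thesis
        unfolding K_def by (simp add: contour_integral_unique)
    qed
    show "(\<integral>\<^sup>+x. ennreal (cmod (K (Complex x y))) * indicator {x. \<bar>Re z\<bar> + 1 \<le> \<bar>x\<bar>} x \<partial>lborel)
        \<le> ennreal (1 * C)" if "a \<le> y" "y \<le> b" for y
    proof (rule strip_bound)
      fix x assume "x \<in> {x. \<bar>Re z\<bar> + 1 \<le> \<bar>x\<bar>}"
      then have "1 \<le> cmod (Complex x y - z)"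
        using abs_Re_le_cmod[of "Complex x y - z"] by auto
      then show "cmod (K (Complex x y)) \<le> 1 * cmod (G (Complex x y))"
        using divide_left_mono[of 1 "cmod (Complex x y - z)" "cmod (G (Complex x y))"]
        by (cases "Complex x y = z") (auto simp: K_def norm_divide)
    qed (use that a in auto)
  qed (use a b int in auto)
  have lim: "((\<lambda>b. LINT x|lborel. K (Complex x b)) \<longlongrightarrow> 0) at_top"
  proof (rule Lim_null_comparison)
    show "\<forall>\<^sub>F b in at_top. cmod (LINT x|lborel. K (Complex x b)) \<le> C * (1 / (b - Im z))"
      using eventually_gt_at_top[of "Im z"]
    proof eventually_elim
      fix b assume b: "Im z < b"
      then show "cmod (LINT x|lborel. K (Complex x b)) \<le> C * (1 / (b - Im z))"
        unfolding eq using inv[of b] a by (intro norm_integral_line_mult_le) auto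
    qed
    show "((\<lambda>b. C * (1 / (b - Im z))) \<longlongrightarrow> 0) at_top"
      by real_asymp
  qed
  have "((\<lambda>b. (LINT x|lborel. K (Complex x a)) - (LINT x|lborel. K (Complex x b))) \<longlongrightarrow>
      (LINT x|lborel. K (Complex x a)) - 0) at_top"
    by (intro tendsto_intros lim)
  moreover have "((\<lambda>b. (LINT x|lborel. K (Complex x a)) - (LINT x|lborel. K (Complex x b))) \<longlongrightarrow>
      2 * pi * \<i> * G z) at_top"
    by (rule tendsto_eventually, rule eventually_mono[OF eventually_gt_at_top[of "Im z"]], rule diff)
  ultimately have "(LINT x|lborel. K (Complex x a)) - 0 = 2 * pi * \<i> * G z"
    by (rule tendsto_unique[rotated]) simp
  then show ?thesis by (simp add: K_def)
qed

text \<open>In Cauchy's formula on a line below \<open>z\<close>, expand the kernel as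
  \<open>1 / (w - z) = \<i> \<integral>\<^sub>0\<^sup>\<infinity> exp (\<i> t (z - w)) dt\<close> and exchange the integrals.\<close>

theorem inversion:
  assumes z: "0 < Im z"
  shows "G z = (LINT t:{0<..}|lborel. half_plane_transform G t * exp (\<i> * of_real t * z))"
proof -
  \<comment> \<open>Any height strictly between \<open>0\<close> and \<open>Im z\<close> would
    do.\<close>
  define a where "a = Im z / 2"
  have a: "0 < a" "a < Im z" using z by (auto simp: a_def)
  have [measurable]: "(\<lambda>x. G (Complex x a)) \<in> borel_measurable borel"
    using a by (intro measurable_line)
  define P where "P x t = indicator {0<..} t *\<^sub>R (G (Complex x a) * exp (\<i> * of_real t * (z - Complex x a)))"
    for x t
  \<comment> \<open>On the line the exponential has modulus \<open>exp (- (t * (Im z - a)))\<close>: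
    the gap between the heights of \<open>z\<close> and of the line gives integrability in
    \<open>t\<close>.\<close>
  have intP: "integrable (lborel \<Otimes>\<^sub>M lborel) (\<lambda>(x, t). P x t)"
  proof (rule integrable_pair_bound)
    show "integrable lborel (\<lambda>x. cmod (G (Complex x a)))"
      using a by (intro integrable_norm integrable_line)
    show "integrable lborel (\<lambda>t. indicator {0<..} t *\<^sub>R exp (- (t * (Im z - a))))"
      using integrable_I0i_exp_mscale[of "Im z - a"] a by (simp add: set_integrable_def)
  qed (auto simp: P_def norm_mult sigma_finite_lborel algebra_simps split: split_indicator)
  have 1: "(LINT t|lborel. P x t) = - \<i> * (G (Complex x a) / (Complex x a - z))" for x
  proof -
    define s where "s = - \<i> * (z - Complex x a)"
    have s: "Re s > 0" using a by (simp add: s_def)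
    have "(LINT t|lborel. P x t) = G (Complex x a) * (LINT t:{0<..}|lborel. exp (- (s * of_real t)))"
      unfolding set_integral_mult_right[symmetric] unfolding P_def set_lebesgue_integral_def s_def
      by (intro Bochner_Integration.integral_cong) (auto simp: algebra_simps)
    also have "\<dots> = - \<i> * (G (Complex x a) / (Complex x a - z))"
    proof -
      have "Complex x a - z \<noteq> 0" using a by (auto simp: complex_eq_iff)
      moreover have "s = \<i> * (Complex x a - z)" by (simp add: s_def algebra_simps)
      ultimately show ?thesis
        unfolding LINT_exp_scale_Ioi[OF s] by (simp only:) (simp add: divide_simps)
    qed
    finally show ?thesis .
  qed
  \<comment> \<open>Here \<open>exp (\<i> t (z - w))\<close> splits into
    \<open>exp (\<i> t z)\<close> and \<open>exp (- \<i> t w)\<close>; the second factor integrates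
    against \<open>G\<close> to \<open>2 * pi\<close> times the transform, computed at height
    \<open>a\<close>.\<close>
  have 2: "(LINT x|lborel. P x t) =
      2 * pi * (indicator {0<..} t *\<^sub>R (half_plane_transform G t * exp (\<i> * of_real t * z)))" for t
  proof -
    have "(LINT x|lborel. P x t) = (LINT x|lborel. (indicator {0<..} t *\<^sub>R exp (\<i> * of_real t * z)) *
        (G (Complex x a) * exp (- (\<i> * of_real t * Complex x a))))"
      unfolding P_def
      by (intro Bochner_Integration.integral_cong) (auto simp: algebra_simps exp_diff exp_minus divide_inverse)
    also have "\<dots> = 2 * pi * (indicator {0<..} t *\<^sub>R (half_plane_transform G t * exp (\<i> * of_real t * z)))"
      unfolding integral_mult_right_zero transform_line[OF a(1)] by simp
    finally show ?thesis .
  qed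
  have "2 * pi * G z = - \<i> * (2 * pi * \<i> * G z)" by simp
  also have "\<dots> = (LINT x|lborel. - \<i> * (G (Complex x a) / (Complex x a - z)))"
    unfolding integral_mult_right_zero cauchy_formula[OF a] ..
  also have "\<dots> = (LINT t|lborel. LINT x|lborel. P x t)"
    unfolding 1[symmetric] using lborel_pair.Fubini_integral[OF intP] by simp
  also have "\<dots> = 2 * pi * (LINT t:{0<..}|lborel. half_plane_transform G t * exp (\<i> * of_real t * z))"
    unfolding 2 integral_mult_right_zero set_lebesgue_integral_def ..
  finally show ?thesis by simp
qed

text \<open>In the integral of \<open>cnj G * G\<close> along the line, the second factor is
  replaced by its inversion formula and the integrals are exchanged. The inner integral over
  \<open>x\<close> is then the conjugate of the transform up to the factor \<open>2 * pi\<close> and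
  the weight.\<close>

theorem plancherel:
  assumes y: "0 < y"
  shows "(\<integral>\<^sup>+t\<in>{0<..}. ennreal ((cmod (half_plane_transform G t))\<^sup>2 * exp (- (2 * y * t))) \<partial>lborel) =
    ennreal (1 / (2 * pi)) * (\<integral>\<^sup>+x. ennreal ((cmod (G (Complex x y)))\<^sup>2) \<partial>lborel)"
proof -
  let ?h = "half_plane_transform G"
  have [measurable]: "(\<lambda>x. G (Complex x y)) \<in> borel_measurable borel"
    "(\<lambda>x. cnj (G (Complex x y))) \<in> borel_measurable borel"
    using y by (auto intro!: borel_measurable_continuous_onI continuous_on_cnj continuous_line)
  define P where "P x t = indicator {0<..} t *\<^sub>R (cnj (G (Complex x y)) * (?h t * exp (\<i> * of_real t * Complex x y)))"
    for x t
  have intP: "integrable (lborel \<Otimes>\<^sub>M lborel) (\<lambda>(x, t). P x t)"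
  proof (rule integrable_pair_bound)
    show "integrable lborel (\<lambda>x. cmod (G (Complex x y)))"
      using y by (intro integrable_norm integrable_line)
    show "integrable lborel (\<lambda>t. C / (2 * pi) * (indicator {0<..} t *\<^sub>R exp (- (t * y))))"
      using integrable_I0i_exp_mscale[of y] y by (simp add: set_integrable_def)
    show "norm (case (x, t) of (x, t) \<Rightarrow> P x t) \<le>
      cmod (G (Complex x y)) * (C / (2 * pi) * (indicator {0<..} t *\<^sub>R exp (- (t * y))))" for x t
      using mult_left_mono[OF mult_right_mono[OF norm_transform_le exp_ge_zero], of "cmod (G (Complex x y))" t "- (t * y)"]
      by (auto simp: P_def norm_mult split: split_indicator)
  qed (use C_nonneg in \<open>auto simp: P_def sigma_finite_lborel split: split_indicator\<close>)
  have 1: "(LINT t|lborel. P x t) = of_real ((cmod (G (Complex x y)))\<^sup>2)" for x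
  proof -
    have "(LINT t|lborel. P x t) =
        cnj (G (Complex x y)) * (LINT t:{0<..}|lborel. ?h t * exp (\<i> * of_real t * Complex x y))"
      unfolding set_integral_mult_right[symmetric] unfolding P_def set_lebesgue_integral_def ..
    also have "\<dots> = cnj (G (Complex x y)) * G (Complex x y)"
      using inversion[of "Complex x y"] y by simp
    finally show ?thesis
      unfolding complex_norm_square by (simp add: mult.commute)
  qed
  have 2: "(LINT x|lborel. P x t) =
      of_real (2 * pi * (indicator {0<..} t * ((cmod (?h t))\<^sup>2 * exp (- (2 * y * t)))))" for t
  proof -
    \<comment> \<open>On a line at positive height conjugation does not merely reverse the sign of
      the exponent; the factor \<open>exp (- (2 * y * t))\<close> makes up the difference in modulus
      and becomes the weight.\<close>
    have e: "exp (\<i> * of_real t * Complex x y) = of_real (exp (- (2 * y * t))) * cnj (exp (- (\<i> * of_real t * Complex x y)))" for x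
    proof -
      have "of_real (exp (- (2 * y * t))) * cnj (exp (- (\<i> * of_real t * Complex x y))) =
          exp (of_real (- (2 * y * t)) + cnj (- (\<i> * of_real t * Complex x y)))"
        by (simp only: exp_add exp_of_real exp_cnj)
      also have "of_real (- (2 * y * t)) + cnj (- (\<i> * of_real t * Complex x y)) = \<i> * of_real t * Complex x y"
        by (simp add: complex_eq_iff)
      finally show ?thesis ..
    qed
    have "(LINT x|lborel. P x t) = (LINT x|lborel. (indicator {0<..} t *\<^sub>R (?h t * of_real (exp (- (2 * y * t))))) *
        cnj (G (Complex x y) * exp (- (\<i> * of_real t * Complex x y))))"
      unfolding P_def e
      by (intro Bochner_Integration.integral_cong) (auto simp: algebra_simps)
    also have "\<dots> = (indicator {0<..} t *\<^sub>R (?h t * of_real (exp (- (2 * y * t))))) *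
        cnj (2 * pi * ?h t)"
      unfolding integral_mult_right_zero Bochner_Integration.integral_cnj transform_line[OF y] by simp
    also have "\<dots> = of_real (2 * pi * (indicator {0<..} t * ((cmod (?h t))\<^sup>2 * exp (- (2 * y * t)))))"
      using complex_norm_square[of "?h t"] by (auto simp: algebra_simps split: split_indicator)
    finally show ?thesis .
  qed
  \<comment> \<open>Fubini's theorem also delivers the square integrability of \<open>G\<close> on
    the line, since the inner integral over \<open>t\<close> is \<open>(cmod G)\<^sup>2\<close> by
    \<open>1\<close>.\<close>
  have i1: "integrable lborel (\<lambda>x. (cmod (G (Complex x y)))\<^sup>2)"
    using lborel_pair.integrable_fst[OF intP] unfolding 1 complex_of_real_integrable_eq .
  have i2: "integrable lborel (\<lambda>t. 2 * pi * (indicator {0<..} t * ((cmod (?h t))\<^sup>2 * exp (- (2 * y * t)))))"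
    using lborel_pair.integrable_snd[OF intP] unfolding 2 complex_of_real_integrable_eq .
  have "(LINT x|lborel. LINT t|lborel. P x t) = (LINT t|lborel. LINT x|lborel. P x t)"
    using lborel_pair.Fubini_integral[OF intP] by simp
  then have eq: "(LINT x|lborel. (cmod (G (Complex x y)))\<^sup>2) =
      (LINT t|lborel. 2 * pi * (indicator {0<..} t * ((cmod (?h t))\<^sup>2 * exp (- (2 * y * t)))))"
    unfolding 1 2 integral_complex_of_real of_real_eq_iff .
  have "(\<integral>\<^sup>+x. ennreal ((cmod (G (Complex x y)))\<^sup>2) \<partial>lborel) =
      (\<integral>\<^sup>+t. ennreal (2 * pi * (indicator {0<..} t * ((cmod (?h t))\<^sup>2 * exp (- (2 * y * t))))) \<partial>lborel)"
    using i1 i2 eq by (subst (1 2) nn_integral_eq_integral) auto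
  also have "\<dots> = (\<integral>\<^sup>+t. ennreal (2 * pi) * (ennreal ((cmod (?h t))\<^sup>2 * exp (- (2 * y * t))) * indicator {0<..} t) \<partial>lborel)"
    by (intro nn_integral_cong) (auto simp: ennreal_mult split: split_indicator)
  also have "\<dots> = ennreal (2 * pi) * (\<integral>\<^sup>+t\<in>{0<..}. ennreal ((cmod (?h t))\<^sup>2 * exp (- (2 * y * t))) \<partial>lborel)"
    by (rule nn_integral_cmult) measurable
  finally show ?thesis
    by (simp add: mult.assoc[symmetric] ennreal_mult[symmetric])
qed

end

text \<open>Lets Plancherel's identity be applied to a difference of two functions, so that
  convergence in L2 on a line becomes a Cauchy property of the transforms.\<close>

lemma hardy_one_diff:
  assumes "hardy_one G C" "hardy_one G' C'"
  shows "hardy_one (\<lambda>z. G z - G' z) (C + C')"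
proof
  interpret G: hardy_one G C by fact
  interpret G': hardy_one G' C' by fact
  show "(\<lambda>z. G z - G' z) holomorphic_on {z. 0 < Im z}"
    by (intro holomorphic_intros G.holomorphic G'.holomorphic)
  show "0 \<le> C + C'" using G.C_nonneg G'.C_nonneg by simp
  fix y :: real assume y: "0 < y"
  have [measurable]: "(\<lambda>x. G (Complex x y)) \<in> borel_measurable borel" "(\<lambda>x. G' (Complex x y)) \<in> borel_measurable borel"
    using y by (auto intro: G.measurable_line G'.measurable_line)
  have "(\<integral>\<^sup>+x. ennreal (cmod (G (Complex x y) - G' (Complex x y))) \<partial>lborel) \<le>
     (\<integral>\<^sup>+x. ennreal (cmod (G (Complex x y))) + ennreal (cmod (G' (Complex x y))) \<partial>lborel)"
    by (intro nn_integral_mono) (simp add: ennreal_plus[symmetric] ennreal_leI norm_triangle_ineq4 del: ennreal_plus)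
  also have "\<dots> = (\<integral>\<^sup>+x. ennreal (cmod (G (Complex x y))) \<partial>lborel) + (\<integral>\<^sup>+x. ennreal (cmod (G' (Complex x y))) \<partial>lborel)"
    by (intro nn_integral_add) auto
  also have "\<dots> \<le> ennreal (C + C')"
    using G.bound[OF y] G'.bound[OF y] G.C_nonneg G'.C_nonneg by (simp add: add_mono)
  finally show "(\<integral>\<^sup>+x. ennreal (cmod (G (Complex x y) - G' (Complex x y))) \<partial>lborel) \<le> ennreal (C + C')" .
qed

lemma half_plane_transform_diff:
  assumes "hardy_one G C" "hardy_one G' C'"
  shows "half_plane_transform (\<lambda>z. G z - G' z) t = half_plane_transform G t - half_plane_transform G' t"
proof -
  interpret G: hardy_one G C by fact
  interpret G': hardy_one G' C' by fact
  show ?thesis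
    unfolding half_plane_transform_def left_diff_distrib
    by (subst Bochner_Integration.integral_diff)
       (auto simp: diff_divide_distrib intro!: G.integrable_line_mult[where B = "exp t"] G'.integrable_line_mult[where B = "exp t"])
qed

section \<open>Weighted square integrals on the half-line\<close>

text \<open>The weight is \<open>(cmod (exp (\<i> t z)))\<^sup>2\<close> for
  \<open>Im z = y\<close>. Extended values make limits and suprema available without integrability
  conditions.\<close>

definition weighted_energy :: "real \<Rightarrow> (real \<Rightarrow> complex) \<Rightarrow> ennreal" where
  "weighted_energy y g = (\<integral>\<^sup>+t\<in>{0<..}. ennreal ((cmod (g t))\<^sup>2 * exp (- (2 * y * t))) \<partial>lborel)"

lemma nn_integral_exp_scale_Ioi:
  assumes "0 < y"
  shows "(\<integral>\<^sup>+t\<in>{0<..}. ennreal (exp (- (y * t))) \<partial>lborel) < \<infinity>"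
proof -
  have "(\<integral>\<^sup>+t. ennreal (norm (indicator {0<..} t *\<^sub>R exp (- (t * y)))) \<partial>lborel) < \<infinity>"
    using integrable_I0i_exp_mscale[OF assms] by (simp add: set_integrable_def integrable_iff_bounded)
  also have "(\<lambda>t. ennreal (norm (indicator {0<..} t *\<^sub>R exp (- (t * y))))) = (\<lambda>t. ennreal (exp (- (y * t))) * indicator {0<..} t)"
    by (auto simp: fun_eq_iff mult.commute split: split_indicator)
  finally show ?thesis .
qed

text \<open>Cauchy-Schwarz with the weight split as
  \<open>exp (- (y * t)) * exp (- (y * t))\<close>. The energy at height \<open>y\<close> thus
  controls Laplace integrals at height \<open>2 * y\<close>.\<close>

lemma weighted_L1_le_energy:
  assumes [measurable]: "g \<in> borel_measurable borel"
  shows "(\<integral>\<^sup>+t\<in>{0<..}. ennreal (cmod (g t) * exp (- (2 * y * t))) \<partial>lborel)\<^sup>2 \<le>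
    weighted_energy y g * (\<integral>\<^sup>+t\<in>{0<..}. ennreal (exp (- (2 * y * t))) \<partial>lborel)"
proof -
  have e: "exp (- (y * t)) * exp (- (y * t)) = exp (- (2 * y * t))" for t
    by (simp add: exp_add[symmetric])
  then have e2: "(exp (- (y * t)))\<^sup>2 = exp (- (2 * y * t))" for t
    by (simp add: power2_eq_square)
  let ?a = "\<lambda>t. ennreal (cmod (g t) * exp (- (y * t))) * indicator {0<..} t"
  let ?b = "\<lambda>t. ennreal (exp (- (y * t))) * indicator {0<..} t :: ennreal"
  have "?a t * ?b t = ennreal (cmod (g t) * exp (- (2 * y * t))) * indicator {0<..} t"
    "(?a t)\<^sup>2 = ennreal ((cmod (g t))\<^sup>2 * exp (- (2 * y * t))) * indicator {0<..} t"
    "(?b t)\<^sup>2 = ennreal (exp (- (2 * y * t))) * indicator {0<..} t" for t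
    by (auto simp: ennreal_power ennreal_mult[symmetric] power_mult_distrib e e2 mult.assoc split: split_indicator)
  moreover have "(\<integral>\<^sup>+t. ?a t * ?b t \<partial>lborel)\<^sup>2 \<le> (\<integral>\<^sup>+t. (?a t)\<^sup>2 \<partial>lborel) * (\<integral>\<^sup>+t. (?b t)\<^sup>2 \<partial>lborel)"
    by (rule Cauchy_Schwarz_nn_integral) measurable
  ultimately show ?thesis unfolding weighted_energy_def by simp
qed

text \<open>A triangle inequality for squares that needs no square roots, with a constant near
  \<open>1\<close> in front of the main term. The cross term is absorbed by Young's
  inequality.\<close>

lemma square_norm_le_eta:
  fixes a b :: complex and \<eta> :: real
  assumes "0 < \<eta>"
  shows "(cmod a)\<^sup>2 \<le> (1 + \<eta>) * (cmod b)\<^sup>2 + (1 + 1 / \<eta>) * (cmod (a - b))\<^sup>2"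
proof -
  have "cmod a \<le> cmod b + cmod (a - b)" by (metis norm_triangle_sub)
  then have "(cmod a)\<^sup>2 \<le> (cmod b + cmod (a - b))\<^sup>2" by (simp add: power_mono)
  also have "\<dots> \<le> (1 + \<eta>) * (cmod b)\<^sup>2 + (1 + 1 / \<eta>) * (cmod (a - b))\<^sup>2"
  proof -
    have "0 \<le> (\<eta> * cmod b - cmod (a - b))\<^sup>2 / \<eta>" using assms by simp
    then show ?thesis using assms by (simp add: power2_eq_square field_simps)
  qed
  finally show ?thesis .
qed

lemma weighted_energy_le_eta:
  assumes "0 < \<eta>" and [measurable]: "g \<in> borel_measurable borel" "h \<in> borel_measurable borel"
  shows "weighted_energy y g \<le> ennreal (1 + \<eta>) * weighted_energy y h +
    ennreal (1 + 1 / \<eta>) * weighted_energy y (\<lambda>t. g t - h t)"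
proof -
  have "weighted_energy y g \<le> (\<integral>\<^sup>+t. ennreal (1 + \<eta>) * (ennreal ((cmod (h t))\<^sup>2 * exp (- (2 * y * t))) * indicator {0<..} t) +
      ennreal (1 + 1 / \<eta>) * (ennreal ((cmod (g t - h t))\<^sup>2 * exp (- (2 * y * t))) * indicator {0<..} t) \<partial>lborel)"
    unfolding weighted_energy_def
  proof (rule nn_integral_mono)
    fix t
    have "(cmod (g t))\<^sup>2 * exp (- (2 * y * t)) \<le>
        ((1 + \<eta>) * (cmod (h t))\<^sup>2 + (1 + 1 / \<eta>) * (cmod (g t - h t))\<^sup>2) * exp (- (2 * y * t))"
      using square_norm_le_eta[OF \<open>0 < \<eta>\<close>, of "g t" "h t"] by (intro mult_right_mono) auto
    then have "ennreal ((cmod (g t))\<^sup>2 * exp (- (2 * y * t))) \<le>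
        ennreal (1 + \<eta>) * ennreal ((cmod (h t))\<^sup>2 * exp (- (2 * y * t))) +
        ennreal (1 + 1 / \<eta>) * ennreal ((cmod (g t - h t))\<^sup>2 * exp (- (2 * y * t)))"
      using \<open>0 < \<eta>\<close> by (simp add: ennreal_mult[symmetric] ennreal_plus[symmetric] algebra_simps ennreal_leI del: ennreal_plus)
    then show "ennreal ((cmod (g t))\<^sup>2 * exp (- (2 * y * t))) * indicator {0<..} t \<le>
        ennreal (1 + \<eta>) * (ennreal ((cmod (h t))\<^sup>2 * exp (- (2 * y * t))) * indicator {0<..} t) +
        ennreal (1 + 1 / \<eta>) * (ennreal ((cmod (g t - h t))\<^sup>2 * exp (- (2 * y * t))) * indicator {0<..} t)"
      by (auto split: split_indicator)
  qed
  also have "\<dots> = ennreal (1 + \<eta>) * weighted_energy y h + ennreal (1 + 1 / \<eta>) * weighted_energy y (\<lambda>t. g t - h t)"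
    unfolding weighted_energy_def by (subst nn_integral_add) (auto simp: nn_integral_cmult)
  finally show ?thesis .
qed

section \<open>Limits in the weighted spaces\<close>

lemma ennreal_le_of_le_one_plus:
  fixes a b :: ennreal
  assumes "\<And>\<eta>. 0 < \<eta> \<Longrightarrow> a \<le> ennreal (1 + \<eta>) * b"
  shows "a \<le> b"
proof (cases "b = \<infinity>")
  case False
  have "((\<lambda>\<eta>. b * ennreal (1 + \<eta>)) \<longlongrightarrow> b * ennreal (1 + 0)) (at_right 0)"
    using False by (intro ennreal_tendsto_cmult tendsto_intros) (auto simp: less_top)
  moreover have "\<forall>\<^sub>F \<eta> in at_right 0. a \<le> b * ennreal (1 + \<eta>)"
    using assms by (auto simp: eventually_at_filter mult.commute)
  ultimately have "a \<le> b * ennreal (1 + 0)"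
    by (rule tendsto_lowerbound) simp
  then show ?thesis by simp
qed simp

text \<open>Continuity of the norm: \<open>weighted_energy_le_eta\<close> compares \<open>f\<close>
  with \<open>g k\<close> in both directions; first \<open>k\<close> tends to infinity, which
  removes the error term, then \<open>\<eta>\<close> tends to \<open>0\<close>.\<close>

lemma tendsto_weighted_energy_unique:
  assumes [measurable]: "\<And>k. g k \<in> borel_measurable borel" "f \<in> borel_measurable borel"
    and d: "(\<lambda>k. weighted_energy y (\<lambda>t. g k t - f t)) \<longlonglongrightarrow> 0"
    and l: "(\<lambda>k. weighted_energy y (g k)) \<longlonglongrightarrow> L"
  shows "weighted_energy y f = L"
proof (rule antisym)
  have sym: "weighted_energy y (\<lambda>t. f t - g k t) = weighted_energy y (\<lambda>t. g k t - f t)" for k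
    unfolding weighted_energy_def by (simp add: norm_minus_commute)
  show "weighted_energy y f \<le> L"
  proof (rule ennreal_le_of_le_one_plus)
    fix \<eta> :: real assume \<eta>: "0 < \<eta>"
    have "(\<lambda>k. ennreal (1 + \<eta>) * weighted_energy y (g k) +
        ennreal (1 + 1 / \<eta>) * weighted_energy y (\<lambda>t. g k t - f t)) \<longlonglongrightarrow>
        ennreal (1 + \<eta>) * L + ennreal (1 + 1 / \<eta>) * 0"
      by (intro tendsto_add ennreal_tendsto_cmult d l) auto
    then show "weighted_energy y f \<le> ennreal (1 + \<eta>) * L"
      using weighted_energy_le_eta[OF \<eta>, of f "g _" y]
      by (intro LIMSEQ_le_const) (auto simp: sym)
  qed
  show "L \<le> weighted_energy y f"
  proof (rule ennreal_le_of_le_one_plus)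
    fix \<eta> :: real assume \<eta>: "0 < \<eta>"
    have "(\<lambda>k. ennreal (1 + \<eta>) * weighted_energy y f +
        ennreal (1 + 1 / \<eta>) * weighted_energy y (\<lambda>t. g k t - f t)) \<longlonglongrightarrow>
        ennreal (1 + \<eta>) * weighted_energy y f + ennreal (1 + 1 / \<eta>) * 0"
      by (intro tendsto_add ennreal_tendsto_cmult d tendsto_const) auto
    then show "L \<le> ennreal (1 + \<eta>) * weighted_energy y f"
      using weighted_energy_le_eta[OF \<eta>, of "g _" f y] l
      by (intro LIMSEQ_le[OF l]) auto
  qed
qed

text \<open>Cauchy-Schwarz bounds the square of each integral by a fixed finite multiple of the
  energy. Squares are compared with \<open>a\<^sup>2\<close>, which avoids roots of extended
  reals.\<close>

lemma tendsto_weighted_L1: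
  assumes y: "0 < y" and [measurable]: "\<And>k. g k \<in> borel_measurable borel"
    and g: "(\<lambda>k. weighted_energy y (g k)) \<longlonglongrightarrow> 0"
  shows "(\<lambda>k. \<integral>\<^sup>+t\<in>{0<..}. ennreal (cmod (g k t) * exp (- (2 * y * t))) \<partial>lborel) \<longlonglongrightarrow> 0"
proof (rule order_tendstoI)
  define c where "c = (\<integral>\<^sup>+t\<in>{0<..}. ennreal (exp (- (2 * y * t))) \<partial>lborel)"
  have c: "c < top"
    using nn_integral_exp_scale_Ioi[of "2 * y"] y by (simp add: c_def)
  have "(\<lambda>k. c * weighted_energy y (g k)) \<longlonglongrightarrow> c * 0"
    by (intro ennreal_tendsto_cmult g c)
  moreover fix a :: ennreal assume "0 < a"
  then have "0 < a\<^sup>2" by (simp add: zero_less_iff_neq_zero)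
  ultimately have "\<forall>\<^sub>F k in sequentially. c * weighted_energy y (g k) < a\<^sup>2"
    by (simp add: order_tendstoD(2))
  then show "\<forall>\<^sub>F k in sequentially. (\<integral>\<^sup>+t\<in>{0<..}. ennreal (cmod (g k t) * exp (- (2 * y * t))) \<partial>lborel) < a"
  proof eventually_elim
    case (elim k)
    show ?case
    proof (rule ccontr)
      assume "\<not> (\<integral>\<^sup>+t\<in>{0<..}. ennreal (cmod (g k t) * exp (- (2 * y * t))) \<partial>lborel) < a"
      then have "a\<^sup>2 \<le> (\<integral>\<^sup>+t\<in>{0<..}. ennreal (cmod (g k t) * exp (- (2 * y * t))) \<partial>lborel)\<^sup>2"
        by (intro power_mono) auto
      also have "\<dots> \<le> c * weighted_energy y (g k)"
        using weighted_L1_le_energy[of "g k" y] by (simp add: c_def mult.commute)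
      finally show False using elim by simp
    qed
  qed
qed simp

lemma weighted_integrable:
  assumes y: "0 < y" and [measurable]: "g \<in> borel_measurable borel"
    and g: "weighted_energy y g < \<infinity>"
  shows "set_integrable lborel {0<..} (\<lambda>t. exp (- (2 * y * t)) *\<^sub>R g t)"
  unfolding set_integrable_def integrable_iff_bounded
proof
  have "(\<integral>\<^sup>+t\<in>{0<..}. ennreal (cmod (g t) * exp (- (2 * y * t))) \<partial>lborel)\<^sup>2 < \<infinity>"
    using weighted_L1_le_energy[of g y] nn_integral_exp_scale_Ioi[of "2 * y"] y g
    by (auto intro: le_less_trans simp: ennreal_mult_less_top)
  then have "(\<integral>\<^sup>+t\<in>{0<..}. ennreal (cmod (g t) * exp (- (2 * y * t))) \<partial>lborel) < \<infinity>"
    by (simp add: power_less_top_ennreal)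
  also have "(\<lambda>t. ennreal (cmod (g t) * exp (- (2 * y * t))) * indicator {0<..} t) =
      (\<lambda>t. ennreal (norm (indicat_real {0<..} t *\<^sub>R exp (- (2 * y * t)) *\<^sub>R g t)))"
    by (auto simp: fun_eq_iff mult.commute split: split_indicator)
  finally show "(\<integral>\<^sup>+t. ennreal (norm (indicat_real {0<..} t *\<^sub>R exp (- (2 * y * t)) *\<^sub>R g t)) \<partial>lborel) < \<infinity>" .
qed measurable

text \<open>Completeness of all the weighted spaces at once, with a common limit. One weight yields
  a subsequence converging almost everywhere; its pointwise limit does not involve the weight, and
  Fatou's lemma gives convergence for every \<open>y\<close>.\<close>

lemma weighted_energy_limit:
  fixes h :: "nat \<Rightarrow> real \<Rightarrow> complex"
  assumes h [measurable]: "\<And>n. h n \<in> borel_measurable borel"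
    and fin: "\<And>n y. 0 < y \<Longrightarrow> weighted_energy y (h n) < \<infinity>"
    and cauchy: "\<And>y e. 0 < y \<Longrightarrow> 0 < e \<Longrightarrow>
      \<exists>N. \<forall>m\<ge>N. \<forall>n\<ge>N. weighted_energy y (\<lambda>t. h m t - h n t) \<le> ennreal e"
  obtains f r where "f \<in> borel_measurable borel" "strict_mono r"
    "\<And>y. 0 < y \<Longrightarrow> (\<lambda>k. weighted_energy y (\<lambda>t. h (r k) t - f t)) \<longlonglongrightarrow> 0"
proof -
  \<comment> \<open>The height \<open>1\<close> is arbitrary: the weight is positive, so pointwise
    convergence of \<open>s\<close> and of \<open>h\<close> is the same for
    \<open>t > 0\<close>.\<close>
  define s where "s n t = indicat_real {0<..} t *\<^sub>R exp (- (2 * 1 * t)) *\<^sub>R h n t" for n t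
  have s: "integrable lborel (s n)" for n
    unfolding s_def using weighted_integrable[of 1 "h n"] fin[of 1 n] by (simp add: set_integrable_def)
  have s_cauchy: "\<exists>N. \<forall>i\<ge>N. \<forall>j\<ge>N. (LINT x|lborel. norm (s i x - s j x)) < e" if e: "0 < e" for e :: real
  proof -
    define c where "c = (\<integral>\<^sup>+t\<in>{0<..}. ennreal (exp (- (2 * 1 * t))) \<partial>lborel)"
    have "c < top"
      using nn_integral_exp_scale_Ioi[of "2"] by (simp add: c_def)
    then obtain \<kappa> where \<kappa>: "c = ennreal \<kappa>" "0 \<le> \<kappa>" by (cases c) auto
    \<comment> \<open>Chosen so that \<open>e' * \<kappa> \<le> (e / 2)\<^sup>2\<close>; using
      \<open>\<kappa> + 1\<close> avoids a zero denominator.\<close>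
    define e' where "e' = e\<^sup>2 / (4 * (\<kappa> + 1))"
    have e': "0 < e'" "e' * \<kappa> \<le> (e / 2)\<^sup>2"
      using e \<kappa> by (auto simp: e'_def field_simps power2_eq_square)
    from cauchy[OF zero_less_one e'(1)] obtain N where
      N: "\<And>m n. N \<le> m \<Longrightarrow> N \<le> n \<Longrightarrow> weighted_energy 1 (\<lambda>t. h m t - h n t) \<le> ennreal e'" by blast
    have "(LINT x|lborel. norm (s i x - s j x)) < e" if ij: "N \<le> i" "N \<le> j" for i j
    proof -
      have "(ennreal (LINT x|lborel. norm (s i x - s j x)))\<^sup>2 = (\<integral>\<^sup>+x. ennreal (norm (s i x - s j x)) \<partial>lborel)\<^sup>2"
        using s by (subst nn_integral_eq_integral) auto
      also have "(\<lambda>x. ennreal (norm (s i x - s j x))) =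
          (\<lambda>t. ennreal (cmod (h i t - h j t) * exp (- (2 * 1 * t))) * indicator {0<..} t)"
        by (auto simp: fun_eq_iff s_def mult.commute scaleR_diff_right[symmetric] split: split_indicator)
      also have "(\<integral>\<^sup>+t\<in>{0<..}. ennreal (cmod (h i t - h j t) * exp (- (2 * 1 * t))) \<partial>lborel)\<^sup>2 \<le>
          weighted_energy 1 (\<lambda>t. h i t - h j t) * c"
        unfolding c_def by (rule weighted_L1_le_energy) measurable
      also have "\<dots> \<le> ennreal e' * ennreal \<kappa>"
        unfolding \<kappa> using N[OF ij] by (rule mult_right_mono) simp
      also have "\<dots> = ennreal (e' * \<kappa>)" using e' \<kappa> by (simp add: ennreal_mult)
      also have "\<dots> \<le> ennreal ((e / 2)\<^sup>2)" using e' by (simp add: ennreal_leI)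
      finally have "(LINT x|lborel. norm (s i x - s j x))\<^sup>2 \<le> (e / 2)\<^sup>2"
        by (simp add: ennreal_power)
      then have "(LINT x|lborel. norm (s i x - s j x)) \<le> e / 2"
        using e by (simp add: power2_le_iff_abs_le)
      then show ?thesis using e by simp
    qed
    then show ?thesis by blast
  qed
  obtain r where r: "strict_mono r" and ae: "AE t in lborel. Cauchy (\<lambda>i. s (r i) t)"
    using cauchy_L1_AE_cauchy_subseq[OF s s_cauchy] by blast
  \<comment> \<open>Where the sequence diverges, \<open>lim\<close> gives an arbitrary value. For
    \<open>t > 0\<close> this happens only on a null set, and energies ignore
    \<open>t \<le> 0\<close>.\<close>
  define f where "f t = lim (\<lambda>i. h (r i) t)" for t
  have f [measurable]: "f \<in> borel_measurable borel"
    unfolding f_def by measurable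
  have conv: "AE t in lborel. 0 < t \<longrightarrow> (\<lambda>i. h (r i) t) \<longlonglongrightarrow> f t"
    using ae
  proof eventually_elim
    case (elim t)
    show ?case
    proof
      assume t: "0 < t"
      from elim obtain l where "(\<lambda>i. s (r i) t) \<longlonglongrightarrow> l"
        by (auto simp: Cauchy_convergent_iff convergent_def)
      then have "convergent (\<lambda>i. exp (2 * t) *\<^sub>R s (r i) t)"
        by (intro convergentI[OF tendsto_scaleR[OF tendsto_const]])
      then have "convergent (\<lambda>i. h (r i) t)"
        using t by (simp add: s_def exp_minus)
      then show "(\<lambda>i. h (r i) t) \<longlonglongrightarrow> f t"
        unfolding f_def by (simp add: convergent_LIMSEQ_iff)
    qed
  qed
  have "(\<lambda>k. weighted_energy y (\<lambda>t. h (r k) t - f t)) \<longlonglongrightarrow> 0" if y: "0 < y" for y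
  proof (rule order_tendstoI)
    fix a :: ennreal assume "0 < a"
    then obtain b where b: "0 < b" "b < a" using dense by blast
    then obtain e where e: "b = ennreal e" "0 < e"
      by (cases b) (auto simp: less_top[symmetric] ennreal_less_zero_iff)
    from cauchy[OF y e(2)] obtain N where
      N: "\<And>m n. N \<le> m \<Longrightarrow> N \<le> n \<Longrightarrow> weighted_energy y (\<lambda>t. h m t - h n t) \<le> ennreal e" by blast
    have "weighted_energy y (\<lambda>t. h (r k) t - f t) \<le> ennreal e" if k: "N \<le> k" for k
    proof -
      \<comment> \<open>Fatou's lemma in \<open>j\<close> with \<open>k\<close> fixed passes the
        Cauchy bound to the limit.\<close>
      let ?u = "\<lambda>j t. ennreal ((cmod (h (r k) t - h (r j) t))\<^sup>2 * exp (- (2 * y * t))) * indicator {0<..} t"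
      have "weighted_energy y (\<lambda>t. h (r k) t - f t) \<le> (\<integral>\<^sup>+t. liminf (\<lambda>j. ?u j t) \<partial>lborel)"
        unfolding weighted_energy_def
      proof (rule nn_integral_mono_AE, use conv in eventually_elim)
        case (elim t)
        show ?case
        proof (cases "0 < t")
          case True
          with elim have "(\<lambda>j. ennreal ((cmod (h (r k) t - h (r j) t))\<^sup>2 * exp (- (2 * y * t)))) \<longlonglongrightarrow>
              ennreal ((cmod (h (r k) t - f t))\<^sup>2 * exp (- (2 * y * t)))"
            by (intro tendsto_intros) auto
          from lim_imp_Liminf[OF sequentially_bot this] show ?thesis using True by simp
        qed simp
      qed
      also have "\<dots> \<le> liminf (\<lambda>j. \<integral>\<^sup>+t. ?u j t \<partial>lborel)"
        by (rule nn_integral_liminf) measurable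
      also have "\<dots> \<le> ennreal e"
      proof (rule Liminf_le)
        show "\<forall>\<^sub>F j in sequentially. (\<integral>\<^sup>+t. ?u j t \<partial>lborel) \<le> ennreal e"
          using eventually_ge_at_top[of N]
        proof eventually_elim
          case (elim j)
          then show ?case
            using N[of "r k" "r j"] k seq_suble[OF r] unfolding weighted_energy_def
            by (meson order_trans)
        qed
      qed simp
      finally show ?thesis .
    qed
    then show "\<forall>\<^sub>F k in sequentially. weighted_energy y (\<lambda>t. h (r k) t - f t) < a"
      using b unfolding e by (intro eventually_sequentiallyI[of N]) (auto intro: le_less_trans)
  qed simp
  then show ?thesis using that f r by blast
qed

section \<open>The Paley-Wiener theorem\<close>

lemma cmod_damping: "(cmod (1 - \<i> * of_real \<delta> * Complex x y))\<^sup>2 = (1 + \<delta> * y)\<^sup>2 + (\<delta> * x)\<^sup>2"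
  by (simp add: cmod_power2)

lemma one_le_cmod_damping:
  assumes "0 \<le> \<delta>" "0 < Im z"
  shows "1 \<le> cmod (1 - \<i> * of_real \<delta> * z)"
proof -
  have "1 \<le> \<bar>Re (1 - \<i> * of_real \<delta> * z)\<bar>" using assms by simp
  also have "\<dots> \<le> cmod (1 - \<i> * of_real \<delta> * z)" by (rule abs_Re_le_cmod)
  finally show ?thesis .
qed

text \<open>With \<open>k\<close> the modulus of the denominator,
  \<open>cmod F / k \<le> (cmod F)\<^sup>2 + 1 / k\<^sup>2\<close>, and both terms have integrals
  bounded independently of the line.\<close>

lemma hardy_one_damped:
  assumes hol: "F holomorphic_on {z. 0 < Im z}"
    and B: "0 \<le> B" "\<And>y. 0 < y \<Longrightarrow> (\<integral>\<^sup>+x. ennreal ((cmod (F (Complex x y)))\<^sup>2) \<partial>lborel) \<le> ennreal B"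
    and \<delta>: "0 < \<delta>"
  obtains C where "hardy_one (\<lambda>z. F z / (1 - \<i> * of_real \<delta> * z)) C"
proof -
  \<comment> \<open>The value of \<open>1 / k\<^sup>2\<close> at height \<open>0\<close>, which
    dominates it at every positive height.\<close>
  define p where "p x = inverse (1 + (\<delta> * x)\<^sup>2)" for x
  have "integrable lborel (\<lambda>x. inverse (1 + x\<^sup>2) :: real)"
    using integrable_inverse_1_plus_square by (simp add: set_integrable_def einterval_def)
  from lborel_integrable_real_affine[OF this, of \<delta> 0] have p: "integrable lborel p"
    using \<delta> by (simp add: p_def[abs_def])
  have p0: "0 \<le> p x" for x by (simp add: p_def)
  have [measurable]: "p \<in> borel_measurable borel" using p by auto
  define I where "I = (LINT x|lborel. p x)"
  have I: "(\<integral>\<^sup>+x. ennreal (p x) \<partial>lborel) = ennreal I" "0 \<le> I"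
    using p p0 unfolding I_def by (auto simp: nn_integral_eq_integral)
  have nz: "1 - \<i> * of_real \<delta> * z \<noteq> 0" if "0 < Im z" for z
    using one_le_cmod_damping[of \<delta> z] \<delta> that by auto
  have "hardy_one (\<lambda>z. F z / (1 - \<i> * of_real \<delta> * z)) (B + I)"
  proof
    show "(\<lambda>z. F z / (1 - \<i> * of_real \<delta> * z)) holomorphic_on {z. 0 < Im z}"
      using nz by (intro holomorphic_intros hol) auto
    show "0 \<le> B + I" using B I by simp
    fix y :: real assume y: "0 < y"
    have [measurable]: "(\<lambda>x. F (Complex x y)) \<in> borel_measurable borel"
      using hol y by (intro borel_measurable_continuous_onI continuous_on_horizontal_line)
    have "(\<integral>\<^sup>+x. ennreal (cmod (F (Complex x y) / (1 - \<i> * of_real \<delta> * Complex x y))) \<partial>lborel) \<le>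
        (\<integral>\<^sup>+x. ennreal ((cmod (F (Complex x y)))\<^sup>2) + ennreal (p x) \<partial>lborel)"
    proof (rule nn_integral_mono)
      fix x
      define k where "k = cmod (1 - \<i> * of_real \<delta> * Complex x y)"
      have k: "k \<ge> 1" using one_le_cmod_damping[of \<delta> "Complex x y"] y \<delta> by (simp add: k_def)
      have "1\<^sup>2 \<le> (1 + \<delta> * y)\<^sup>2" using y \<delta> by (intro power_mono) auto
      then have "1 + (\<delta> * x)\<^sup>2 \<le> k\<^sup>2"
        unfolding k_def cmod_damping by simp
      then have "inverse (k\<^sup>2) \<le> p x"
        unfolding p_def by (intro le_imp_inverse_le) (simp_all add: add_pos_nonneg)
      moreover have "cmod (F (Complex x y)) * inverse k \<le> (cmod (F (Complex x y)))\<^sup>2 + (inverse k)\<^sup>2"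
      proof -
        have "0 \<le> cmod (F (Complex x y)) * inverse k" using k by simp
        then show ?thesis
          using sum_squares_bound[of "cmod (F (Complex x y))" "inverse k"] by linarith
      qed
      ultimately have "cmod (F (Complex x y)) / k \<le> (cmod (F (Complex x y)))\<^sup>2 + p x"
        by (simp add: divide_inverse power_inverse)
      then show "ennreal (cmod (F (Complex x y) / (1 - \<i> * of_real \<delta> * Complex x y))) \<le>
          ennreal ((cmod (F (Complex x y)))\<^sup>2) + ennreal (p x)"
        using p0[of x] by (simp add: norm_divide k_def ennreal_plus[symmetric] ennreal_leI del: ennreal_plus)
    qed
    also have "\<dots> = (\<integral>\<^sup>+x. ennreal ((cmod (F (Complex x y)))\<^sup>2) \<partial>lborel) + ennreal I"
      by (subst nn_integral_add) (auto simp: I)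
    also have "\<dots> \<le> ennreal (B + I)"
      using B I y by (simp add: add_right_mono)
    finally show "(\<integral>\<^sup>+x. ennreal (cmod (F (Complex x y) / (1 - \<i> * of_real \<delta> * Complex x y))) \<partial>lborel) \<le> ennreal (B + I)" .
  qed
  then show ?thesis by (rule that)
qed

text \<open>The weight is at most \<open>1\<close> and tends to \<open>1\<close> as \<open>y\<close>
  tends to \<open>0\<close>. Fatou's lemma along the heights \<open>1 / Suc n\<close> gives the
  nontrivial inequality.\<close>

lemma SUP_weighted_energy:
  assumes [measurable]: "f \<in> borel_measurable borel"
  shows "(SUP y\<in>{0<..}. weighted_energy y f) = (\<integral>\<^sup>+t\<in>{0<..}. ennreal ((cmod (f t))\<^sup>2) \<partial>lborel)"
proof (rule antisym)
  show "(SUP y\<in>{0<..}. weighted_energy y f) \<le> (\<integral>\<^sup>+t\<in>{0<..}. ennreal ((cmod (f t))\<^sup>2) \<partial>lborel)"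
    unfolding weighted_energy_def
    by (intro SUP_least nn_integral_mono)
       (simp add: mult_right_le_one_le ennreal_leI split: split_indicator)
  define u where "u n t = ennreal ((cmod (f t))\<^sup>2 * exp (- (2 * (1 / Suc n) * t))) * indicator {0<..} t" for n t
  have [measurable]: "u n \<in> borel_measurable lborel" for n unfolding u_def by measurable
  have "(\<integral>\<^sup>+t\<in>{0<..}. ennreal ((cmod (f t))\<^sup>2) \<partial>lborel) \<le> (\<integral>\<^sup>+t. liminf (\<lambda>n. u n t) \<partial>lborel)"
  proof (rule nn_integral_mono)
    fix t
    have "(\<lambda>n. exp (- (2 * (1 / Suc n) * t))) \<longlonglongrightarrow> exp (- (2 * 0 * t))"
      by (intro tendsto_intros LIMSEQ_inverse_real_of_nat[unfolded inverse_eq_divide])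
    then have "(\<lambda>n. ennreal ((cmod (f t))\<^sup>2 * exp (- (2 * (1 / Suc n) * t)))) \<longlonglongrightarrow> ennreal ((cmod (f t))\<^sup>2 * exp (- (2 * 0 * t)))"
      by (intro tendsto_ennrealI tendsto_mult[OF tendsto_const])
    from lim_imp_Liminf[OF sequentially_bot this]
    show "ennreal ((cmod (f t))\<^sup>2) * indicator {0<..} t \<le> liminf (\<lambda>n. u n t)"
      by (auto simp: u_def split: split_indicator)
  qed
  also have "\<dots> \<le> liminf (\<lambda>n. \<integral>\<^sup>+t. u n t \<partial>lborel)"
    by (rule nn_integral_liminf) measurable
  also have "\<dots> \<le> (SUP y\<in>{0<..}. weighted_energy y f)"
  proof (rule Liminf_le)
    show "\<forall>\<^sub>F n in sequentially. (\<integral>\<^sup>+t. u n t \<partial>lborel) \<le> (SUP y\<in>{0<..}. weighted_energy y f)"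
    proof (intro always_eventually allI)
      fix n
      have "(\<integral>\<^sup>+t. u n t \<partial>lborel) = weighted_energy (1 / Suc n) f"
        by (simp add: u_def weighted_energy_def)
      also have "\<dots> \<le> (SUP y\<in>{0<..}. weighted_energy y f)"
        by (rule SUP_upper) simp
      finally show "(\<integral>\<^sup>+t. u n t \<partial>lborel) \<le> (SUP y\<in>{0<..}. weighted_energy y f)" .
    qed
  qed simp
  finally show "(\<integral>\<^sup>+t\<in>{0<..}. ennreal ((cmod (f t))\<^sup>2) \<partial>lborel) \<le> (SUP y\<in>{0<..}. weighted_energy y f)" .
qed

theorem paley_wiener_half_plane:
  fixes F :: "complex \<Rightarrow> complex" and M :: ennreal
  assumes hol: "F holomorphic_on {z. 0 < Im z}"
    and M: "(SUP y\<in>{0<..}. ennreal (1 / (2 * pi)) * (\<integral>\<^sup>+x. ennreal ((cmod (F (Complex x y)))\<^sup>2) \<partial>lborel)) = M"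
    and fin: "M < \<infinity>"
  obtains f where "f \<in> borel_measurable lborel" "integrable lborel (\<lambda>t. (cmod (f t))\<^sup>2)"
    "\<And>z. 0 < Im z \<Longrightarrow> F z = (LINT t:{0<..}|lborel. f t * exp (\<i> * of_real t * z))"
    "(\<integral>\<^sup>+t\<in>{0<..}. ennreal ((cmod (f t))\<^sup>2) \<partial>lborel) = M"
proof -
  define A where "A y = (\<integral>\<^sup>+x. ennreal ((cmod (F (Complex x y)))\<^sup>2) \<partial>lborel)" for y
  obtain m where m: "M = ennreal m" "0 \<le> m" using fin by (cases M) auto
  have A_le: "A y \<le> ennreal (2 * pi * m)" if y: "0 < y" for y
  proof -
    have "ennreal (1 / (2 * pi)) * A y \<le> M"
      unfolding M[symmetric] A_def using y by (intro SUP_upper) auto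
    then have "ennreal (2 * pi) * (ennreal (1 / (2 * pi)) * A y) \<le> ennreal (2 * pi) * M"
      by (rule mult_left_mono) simp
    then show ?thesis
      using m by (simp add: mult.assoc[symmetric] ennreal_mult[symmetric])
  qed
  have Fmeas: "(\<lambda>x. F (Complex x y)) \<in> borel_measurable borel" if "0 < y" for y
    using hol that by (intro borel_measurable_continuous_onI continuous_on_horizontal_line)
  define \<delta> where "\<delta> n = 1 / real (Suc n)" for n
  have \<delta>: "0 < \<delta> n" for n by (simp add: \<delta>_def)
  have \<delta>_lim: "\<delta> \<longlonglongrightarrow> 0"
    unfolding \<delta>_def using LIMSEQ_inverse_real_of_nat by (simp add: inverse_eq_divide)
  define G where "G n z = F z / (1 - \<i> * of_real (\<delta> n) * z)" for n z
  have "\<exists>C. hardy_one (G n) C" for n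
  proof -
    have "0 \<le> 2 * pi * m" using m by simp
    from hardy_one_damped[OF hol this A_le[unfolded A_def] \<delta>] show ?thesis
      unfolding G_def by blast
  qed
  \<comment> \<open>The constants \<open>C n\<close> may grow with \<open>n\<close>; the limits
    below rely on the domination of \<open>G n\<close> by \<open>F\<close> in L2 instead.\<close>
  then obtain C where C: "\<And>n. hardy_one (G n) (C n)" by metis
  have G_le: "cmod (G n z) \<le> cmod (F z)" if "0 < Im z" for n z
    using one_le_cmod_damping[of "\<delta> n" z] \<delta>[of n] that
      divide_left_mono[of 1 "cmod (1 - \<i> * of_real (\<delta> n) * z)" "cmod (F z)"]
    by (cases "1 - \<i> * of_real (\<delta> n) * z = 0") (auto simp: G_def norm_divide less_imp_le)
  have G_lim: "(\<lambda>n. G n z) \<longlonglongrightarrow> F z" for z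
  proof -
    have "(\<lambda>n. F z / (1 - \<i> * of_real (\<delta> n) * z)) \<longlonglongrightarrow> F z / (1 - \<i> * of_real 0 * z)"
      by (intro tendsto_intros \<delta>_lim) auto
    then show ?thesis by (simp add: G_def)
  qed
  have Gmeas: "(\<lambda>x. G n (Complex x y)) \<in> borel_measurable borel" if "0 < y" for n y
    using hardy_one.measurable_line[OF C that] .
  define h where "h n = half_plane_transform (G n)" for n
  have h [measurable]: "h n \<in> borel_measurable borel" for n
    unfolding h_def by (rule hardy_one.transform_measurable[OF C])
  have energy: "weighted_energy y (h n) = ennreal (1 / (2 * pi)) * (\<integral>\<^sup>+x. ennreal ((cmod (G n (Complex x y)))\<^sup>2) \<partial>lborel)"
    if "0 < y" for y n
    unfolding weighted_energy_def h_def by (rule hardy_one.plancherel[OF C that])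
  have energy_diff: "weighted_energy y (\<lambda>t. h j t - h k t) =
      ennreal (1 / (2 * pi)) * (\<integral>\<^sup>+x. ennreal ((cmod (G j (Complex x y) - G k (Complex x y)))\<^sup>2) \<partial>lborel)"
    if "0 < y" for y j k
    using hardy_one.plancherel[OF hardy_one_diff[OF C C] that]
    unfolding weighted_energy_def h_def half_plane_transform_diff[OF C C] .
  have energy_lim: "(\<lambda>n. weighted_energy y (h n)) \<longlonglongrightarrow> ennreal (1 / (2 * pi)) * A y" if y: "0 < y" for y
    unfolding energy[OF y] A_def
  proof (intro ennreal_tendsto_cmult nn_integral_dominated_convergence)
    show "(\<integral>\<^sup>+x. ennreal ((cmod (F (Complex x y)))\<^sup>2) \<partial>lborel) < \<infinity>"
      using A_le[OF y] unfolding A_def by (rule le_less_trans) simp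
    show "AE x in lborel. ennreal ((cmod (G n (Complex x y)))\<^sup>2) \<le> ennreal ((cmod (F (Complex x y)))\<^sup>2)" for n
      using G_le y by (auto intro!: ennreal_leI power_mono)
    show "AE x in lborel. (\<lambda>n. ennreal ((cmod (G n (Complex x y)))\<^sup>2)) \<longlonglongrightarrow> ennreal ((cmod (F (Complex x y)))\<^sup>2)"
      by (intro AE_I2 tendsto_intros G_lim)
  qed (use Fmeas[OF y] Gmeas[OF y] in \<open>auto intro!: measurable_compose[OF _ measurable_ennreal] borel_measurable_power borel_measurable_norm\<close>)
  define D where "D n y = (\<integral>\<^sup>+x. ennreal ((cmod (G n (Complex x y) - F (Complex x y)))\<^sup>2) \<partial>lborel)" for n y
  have D_lim: "(\<lambda>n. D n y) \<longlonglongrightarrow> 0" if y: "0 < y" for y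
  proof -
    note [measurable] = Fmeas[OF y] Gmeas[OF y]
    have "(\<lambda>n. D n y) \<longlonglongrightarrow> (\<integral>\<^sup>+x. ennreal ((cmod (F (Complex x y) - F (Complex x y)))\<^sup>2) \<partial>(lborel :: real measure))"
      unfolding D_def
    \<comment> \<open>The \<open>4\<close> is the square of the \<open>2\<close> in
      \<open>cmod (G n - F) \<le> 2 * cmod F\<close>.\<close>
    proof (rule nn_integral_dominated_convergence[where w = "\<lambda>x. ennreal 4 * ennreal ((cmod (F (Complex x y)))\<^sup>2)"])
      have "(\<integral>\<^sup>+x. ennreal 4 * ennreal ((cmod (F (Complex x y)))\<^sup>2) \<partial>lborel) = ennreal 4 * A y"
        unfolding A_def by (rule nn_integral_cmult) measurable
      also have "\<dots> < \<infinity>"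
        using A_le[OF y] by (auto simp: ennreal_mult_less_top intro: le_less_trans)
      finally show "(\<integral>\<^sup>+x. ennreal 4 * ennreal ((cmod (F (Complex x y)))\<^sup>2) \<partial>lborel) < \<infinity>" .
      show "AE x in lborel. ennreal ((cmod (G n (Complex x y) - F (Complex x y)))\<^sup>2) \<le> ennreal 4 * ennreal ((cmod (F (Complex x y)))\<^sup>2)" for n
      proof (rule AE_I2)
        fix x
        have "cmod (G n (Complex x y) - F (Complex x y)) \<le> 2 * cmod (F (Complex x y))"
          using norm_triangle_ineq4[of "G n (Complex x y)" "F (Complex x y)"] G_le[of "Complex x y" n] y by simp
        then have "(cmod (G n (Complex x y) - F (Complex x y)))\<^sup>2 \<le> (2 * cmod (F (Complex x y)))\<^sup>2"
          by (rule power_mono) simp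
        then show "ennreal ((cmod (G n (Complex x y) - F (Complex x y)))\<^sup>2) \<le> ennreal 4 * ennreal ((cmod (F (Complex x y)))\<^sup>2)"
          unfolding ennreal_mult[symmetric, OF zero_le_numeral zero_le_power2] by (intro ennreal_leI) (simp add: power_mult_distrib)
      qed
      show "AE x in lborel. (\<lambda>n. ennreal ((cmod (G n (Complex x y) - F (Complex x y)))\<^sup>2)) \<longlonglongrightarrow>
          ennreal ((cmod (F (Complex x y) - F (Complex x y)))\<^sup>2)"
        by (intro AE_I2 tendsto_intros G_lim)
    qed measurable
    then show ?thesis by simp
  qed
  have energy_diff_le: "weighted_energy y (\<lambda>t. h j t - h k t) \<le> ennreal (1 / pi) * D j y + ennreal (1 / pi) * D k y"
    if y: "0 < y" for y j k
  proof -
    note [measurable] = Fmeas[OF y] Gmeas[OF y]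
    have "(\<integral>\<^sup>+x. ennreal ((cmod (G j (Complex x y) - G k (Complex x y)))\<^sup>2) \<partial>lborel) \<le>
        (\<integral>\<^sup>+x. ennreal 2 * ennreal ((cmod (G j (Complex x y) - F (Complex x y)))\<^sup>2) +
          ennreal 2 * ennreal ((cmod (G k (Complex x y) - F (Complex x y)))\<^sup>2) \<partial>lborel)"
    proof (rule nn_integral_mono)
      fix x
      \<comment> \<open>Young's inequality with \<open>\<eta> = 1\<close>, using
        \<open>(G j - G k) - (G j - F) = F - G k\<close>.\<close>
      have "(cmod (G j (Complex x y) - G k (Complex x y)))\<^sup>2 \<le>
          2 * (cmod (G j (Complex x y) - F (Complex x y)))\<^sup>2 + 2 * (cmod (G k (Complex x y) - F (Complex x y)))\<^sup>2"
        using square_norm_le_eta[of 1 "G j (Complex x y) - F (Complex x y)" "G k (Complex x y) - F (Complex x y)"]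
          square_norm_le_eta[of 1 "G j (Complex x y) - G k (Complex x y)" "G j (Complex x y) - F (Complex x y)"]
        by (simp add: norm_minus_commute)
      then show "ennreal ((cmod (G j (Complex x y) - G k (Complex x y)))\<^sup>2) \<le>
          ennreal 2 * ennreal ((cmod (G j (Complex x y) - F (Complex x y)))\<^sup>2) +
          ennreal 2 * ennreal ((cmod (G k (Complex x y) - F (Complex x y)))\<^sup>2)"
        by (subst (1 2) ennreal_mult[symmetric]) (auto simp: ennreal_plus[symmetric] ennreal_leI simp del: ennreal_plus)
    qed
    also have "\<dots> = ennreal 2 * D j y + ennreal 2 * D k y"
      unfolding D_def by (subst nn_integral_add) (auto simp: nn_integral_cmult)
    finally have "weighted_energy y (\<lambda>t. h j t - h k t) \<le> ennreal (1 / (2 * pi)) * (ennreal 2 * D j y + ennreal 2 * D k y)"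
      unfolding energy_diff[OF y] by (rule mult_left_mono) simp
    also have "\<dots> = (ennreal (1 / (2 * pi)) * ennreal 2) * D j y + (ennreal (1 / (2 * pi)) * ennreal 2) * D k y"
      by (simp only: distrib_left mult.assoc)
    also have "ennreal (1 / (2 * pi)) * ennreal 2 = ennreal (1 / pi)"
      by (subst ennreal_mult[symmetric]) auto
    finally show ?thesis .
  qed
  have h_fin: "weighted_energy y (h n) < \<infinity>" if y: "0 < y" for n y
  proof -
    have "(\<integral>\<^sup>+x. ennreal ((cmod (G n (Complex x y)))\<^sup>2) \<partial>lborel) \<le> A y"
      unfolding A_def using G_le y by (intro nn_integral_mono ennreal_leI power_mono) auto
    also have "\<dots> < \<infinity>" using A_le[OF y] by (rule le_less_trans) simp
    finally show ?thesis unfolding energy[OF y] by (simp add: ennreal_mult_less_top)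
  qed
  have h_cauchy: "\<exists>N. \<forall>j\<ge>N. \<forall>k\<ge>N. weighted_energy y (\<lambda>t. h j t - h k t) \<le> ennreal e" if y: "0 < y" and e: "0 < e" for y e
  proof -
    have "(\<lambda>n. ennreal (1 / pi) * D n y) \<longlonglongrightarrow> ennreal (1 / pi) * 0"
      by (intro ennreal_tendsto_cmult D_lim y) simp
    then have "\<forall>\<^sub>F n in sequentially. ennreal (1 / pi) * D n y < ennreal (e / 2)"
      using e by (intro order_tendstoD(2)) auto
    then obtain N where N: "\<And>n. N \<le> n \<Longrightarrow> ennreal (1 / pi) * D n y < ennreal (e / 2)"
      by (auto simp: eventually_sequentially)
    have "weighted_energy y (\<lambda>t. h j t - h k t) \<le> ennreal e" if "N \<le> j" "N \<le> k" for j k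
    proof -
      have "weighted_energy y (\<lambda>t. h j t - h k t) \<le> ennreal (e / 2) + ennreal (e / 2)"
        using energy_diff_le[OF y, of j k] N[OF that(1)] N[OF that(2)]
        by (meson add_mono less_imp_le order_trans)
      also have "\<dots> = ennreal e" using e by (simp add: ennreal_plus[symmetric] del: ennreal_plus)
      finally show ?thesis .
    qed
    then show ?thesis by blast
  qed
  obtain f r where f [measurable]: "f \<in> borel_measurable borel" and r: "strict_mono r"
    and lim: "\<And>y. 0 < y \<Longrightarrow> (\<lambda>k. weighted_energy y (\<lambda>t. h (r k) t - f t)) \<longlonglongrightarrow> 0"
    using weighted_energy_limit[OF h h_fin h_cauchy] by blast
  \<comment> \<open>The energies of \<open>h (r k)\<close> have the limit given by
    \<open>energy_lim\<close>, and \<open>h (r k)\<close> tends to \<open>f\<close> in the weighted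
    norm, so that limit is the energy of \<open>f\<close>.\<close>
  have energy_f: "weighted_energy y f = ennreal (1 / (2 * pi)) * A y" if y: "0 < y" for y
    using LIMSEQ_subseq_LIMSEQ[OF energy_lim[OF y] r]
    by (intro tendsto_weighted_energy_unique[OF _ _ lim[OF y]]) (auto simp: o_def)
  have norm_f: "(\<integral>\<^sup>+t\<in>{0<..}. ennreal ((cmod (f t))\<^sup>2) \<partial>lborel) = M"
    unfolding SUP_weighted_energy[OF f, symmetric] M[symmetric] A_def[symmetric]
    by (intro SUP_cong) (auto simp: energy_f)
  have rep: "F z = (LINT t:{0<..}|lborel. f t * exp (\<i> * of_real t * z))" if z: "0 < Im z" for z
  proof -
    \<comment> \<open>With half the height of \<open>z\<close>, the weight
      \<open>exp (- (2 * y * t))\<close> of the L1 estimate is exactly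
      \<open>cmod (exp (\<i> t z))\<close>.\<close>
    define y where "y = Im z / 2"
    have y: "0 < y" "2 * y = Im z" using z by (auto simp: y_def)
    have int: "integrable lborel (\<lambda>t. indicator {0<..} t *\<^sub>R (g t * exp (\<i> * of_real t * z)))"
      if [measurable]: "g \<in> borel_measurable borel" and "weighted_energy y g < \<infinity>" for g
    proof (rule Bochner_Integration.integrable_bound)
      show "integrable lborel (\<lambda>t. indicator {0<..} t *\<^sub>R exp (- (2 * y * t)) *\<^sub>R g t)"
        using weighted_integrable[OF y(1) that] by (simp add: set_integrable_def)
    qed (auto simp: norm_mult y_def mult_ac split: split_indicator)
    have f_fin: "weighted_energy y f < \<infinity>"
      unfolding energy_f[OF y(1)] using le_less_trans[OF A_le[OF y(1)]] by (simp add: ennreal_mult_less_top)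
    have "(\<lambda>k. LINT t|lborel. indicator {0<..} t *\<^sub>R (h (r k) t * exp (\<i> * of_real t * z))) \<longlonglongrightarrow>
        (LINT t|lborel. indicator {0<..} t *\<^sub>R (f t * exp (\<i> * of_real t * z)))"
    proof (rule tendsto_L1_int)
      have eq: "(\<lambda>t. ennreal (cmod (h (r k) t - f t) * exp (- (2 * y * t))) * indicator {0<..} t) =
        (\<lambda>t. ennreal (norm (indicator {0<..} t *\<^sub>R (h (r k) t * exp (\<i> * of_real t * z)) -
           indicator {0<..} t *\<^sub>R (f t * exp (\<i> * of_real t * z)))))" for k
        by (auto simp: fun_eq_iff left_diff_distrib[symmetric] norm_mult y_def mult_ac split: split_indicator)
      show "(\<lambda>k. \<integral>\<^sup>+t. ennreal (norm (indicator {0<..} t *\<^sub>R (h (r k) t * exp (\<i> * of_real t * z)) -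
           indicator {0<..} t *\<^sub>R (f t * exp (\<i> * of_real t * z)))) \<partial>lborel) \<longlonglongrightarrow> 0"
        using tendsto_weighted_L1[OF y(1) _ lim[OF y(1)]] unfolding eq by simp
    qed (rule int[OF h h_fin[OF y(1)]] int[OF f f_fin])+
    moreover have "(LINT t|lborel. indicator {0<..} t *\<^sub>R (h (r k) t * exp (\<i> * of_real t * z))) = G (r k) z" for k
      using hardy_one.inversion[OF C z, of "r k"] by (simp add: h_def set_lebesgue_integral_def)
    ultimately have "(\<lambda>k. G (r k) z) \<longlonglongrightarrow> (LINT t|lborel. indicator {0<..} t *\<^sub>R (f t * exp (\<i> * of_real t * z)))"
      by simp
    moreover have "(\<lambda>k. G (r k) z) \<longlonglongrightarrow> F z"
      using LIMSEQ_subseq_LIMSEQ[OF G_lim r] by (simp add: o_def)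
    ultimately show ?thesis
      unfolding set_lebesgue_integral_def by (rule LIMSEQ_unique[rotated])
  qed
  \<comment> \<open>The energies say nothing about \<open>f\<close> on the nonpositive reals;
    setting it to \<open>0\<close> there puts it in L2 of the whole line.\<close>
  define f0 where "f0 t = indicator {0<..} t *\<^sub>R f t" for t
  have f0 [measurable]: "f0 \<in> borel_measurable borel" unfolding f0_def by measurable
  show ?thesis
  proof (rule that[of f0])
    show "f0 \<in> borel_measurable lborel" by simp
    have "(\<integral>\<^sup>+t. ennreal (norm ((cmod (f0 t))\<^sup>2)) \<partial>lborel) = (\<integral>\<^sup>+t\<in>{0<..}. ennreal ((cmod (f t))\<^sup>2) \<partial>lborel)"
      by (intro nn_integral_cong) (auto simp: f0_def split: split_indicator)
    then show "integrable lborel (\<lambda>t. (cmod (f0 t))\<^sup>2)"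
      using fin norm_f by (intro integrableI_bounded) auto
    show "F z = (LINT t:{0<..}|lborel. f0 t * exp (\<i> * of_real t * z))" if "0 < Im z" for z
      unfolding rep[OF that] by (rule set_lebesgue_integral_cong) (auto simp: f0_def)
    have "(\<integral>\<^sup>+t\<in>{0<..}. ennreal ((cmod (f0 t))\<^sup>2) \<partial>lborel) = (\<integral>\<^sup>+t\<in>{0<..}. ennreal ((cmod (f t))\<^sup>2) \<partial>lborel)"
      by (intro nn_integral_cong) (auto simp: f0_def split: split_indicator)
    then show "(\<integral>\<^sup>+t\<in>{0<..}. ennreal ((cmod (f0 t))\<^sup>2) \<partial>lborel) = M" using norm_f by simp
  qed
qed

section \<open>Passage from the two components to bicomplex functions\<close>

theorem theorem3p1:
  fixes F :: "bicomplex \<Rightarrow> bicomplex" and M :: ehyperbolic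
  assumes "bc_holomorphic_on F bc_upper_half_plane"
    and "(SUP (x1, x2)\<in>{(x1, x2). x1 > \<bar>x2\<bar>}.
           ehyp_scale (1 / (2 * pi))
             (D_nn_integral (-\<infinity>) \<infinity>
               (\<lambda>t. (hyp_norm (F (t + bc_i * of_real x1 + bc_j * of_real x2)))\<^sup>2))) = M"
    and "ehyp_finite M"
  shows "\<exists>f\<in>L2_hyperbolic.
           (\<forall>Z\<in>bc_upper_half_plane. F Z = D_integral 0 \<infinity> (\<lambda>t. f t * exp (bc_i * t * Z))) \<and>
           D_nn_integral 0 \<infinity> (\<lambda>t. (hyp_norm (f t))\<^sup>2) = M"
proof -
  obtain F1 F2 where hol: "F1 holomorphic_on {z. 0 < Im z}" "F2 holomorphic_on {z. 0 < Im z}"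
    and F: "\<And>z1 z2. 0 < Im z1 \<Longrightarrow> 0 < Im z2 \<Longrightarrow>
       F (bc_e * bc_of_complex z1 + bc_ed * bc_of_complex z2) =
         bc_e * bc_of_complex (F1 z1) + bc_ed * bc_of_complex (F2 z2)"
    using bc_holomorphic_on_imp_decomp[OF assms(1)] by blast
  define A where "A G y = ennreal (1 / (2 * pi)) * (\<integral>\<^sup>+s. ennreal ((cmod (G (Complex s y)))\<^sup>2) \<partial>lborel)"
    for G :: "complex \<Rightarrow> complex" and y
  let ?S = "{(x1, x2). x1 > \<bar>x2\<bar>} :: (real \<times> real) set"
  have "M = (SUP (x1, x2)\<in>?S. (A F1 (x1 - x2), A F2 (x1 + x2)))"
    unfolding assms(2)[symmetric]
    by (intro SUP_cong refl)
       (auto simp: D_nn_integral_line[where F = F and ?F1.0 = F1 and ?F2.0 = F2, OF F] ehyp_scale_def A_def)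
  then have M: "fst M = (SUP p\<in>?S. A F1 (fst p - snd p))" "snd M = (SUP p\<in>?S. A F2 (fst p + snd p))"
    by (simp_all add: fst_SUP snd_SUP case_prod_beta)
  \<comment> \<open>The supremum of pairs is componentwise, so each component of \<open>M\<close> is
    a supremum over a single height; the choice \<open>x2 = 0\<close> already attains every positive
    height.\<close>
  have range: "(\<lambda>p. fst p - snd p) ` ?S = {0<..}" "(\<lambda>p. fst p + snd p) ` ?S = {0<..}"
    by (auto simp: image_iff) (metis abs_zero diff_zero, metis abs_zero add_0_right)
  have sup1: "(SUP y\<in>{0<..}. A F1 y) = fst M"
    unfolding M range(1)[symmetric] image_image ..
  have sup2: "(SUP y\<in>{0<..}. A F2 y) = snd M"
    unfolding M range(2)[symmetric] image_image ..
  have fin: "fst M < \<infinity>" "snd M < \<infinity>"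
    using assms(3) by (auto simp: ehyp_finite_def)
  from paley_wiener_half_plane[OF hol(1) sup1[unfolded A_def] fin(1)]
  obtain f1 where f1: "f1 \<in> L2"
    "\<And>z. 0 < Im z \<Longrightarrow> F1 z = (LINT t:{0<..}|lborel. f1 t * exp (\<i> * of_real t * z))"
    "(\<integral>\<^sup>+t\<in>{0<..}. ennreal ((cmod (f1 t))\<^sup>2) \<partial>lborel) = fst M"
    unfolding L2_def by blast
  from paley_wiener_half_plane[OF hol(2) sup2[unfolded A_def] fin(2)]
  obtain f2 where f2: "f2 \<in> L2"
    "\<And>z. 0 < Im z \<Longrightarrow> F2 z = (LINT t:{0<..}|lborel. f2 t * exp (\<i> * of_real t * z))"
    "(\<integral>\<^sup>+t\<in>{0<..}. ennreal ((cmod (f2 t))\<^sup>2) \<partial>lborel) = snd M"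
    unfolding L2_def by blast
  have Ioi: "einterval 0 \<infinity> = {0<..}" by (auto simp: einterval_def)
  \<comment> \<open>Taking real parts extends the product-type function from the hyperbolic numbers
    to all bicomplex numbers.\<close>
  define f where "f Z = bc_e * bc_of_complex (f1 (Re (beta1 Z))) + bc_ed * bc_of_complex (f2 (Re (beta2 Z)))" for Z
  have f: "f (bc_e * of_real s1 + bc_ed * of_real s2) = bc_e * bc_of_complex (f1 s1) + bc_ed * bc_of_complex (f2 s2)" for s1 s2
    by (simp add: f_def)
  have "f \<in> L2_hyperbolic"
    unfolding L2_hyperbolic_def using f1(1) f2(1) f by blast
  moreover have "F Z = D_integral 0 \<infinity> (\<lambda>t. f t * exp (bc_i * t * Z))" if Z: "Z \<in> bc_upper_half_plane" for Z
  proof -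
    have Im: "0 < Im (beta1 Z)" "0 < Im (beta2 Z)"
      using Z by (auto simp: bc_upper_half_plane_def)
    have "D_integral 0 \<infinity> (\<lambda>t. f t * exp (bc_i * t * Z)) =
        bc_e * bc_of_complex (LINT t:{0<..}|lborel. f1 t * exp (\<i> * of_real t * beta1 Z)) +
        bc_ed * bc_of_complex (LINT t:{0<..}|lborel. f2 t * exp (\<i> * of_real t * beta2 Z))"
      unfolding Ioi[symmetric] by (rule D_integral_product) (simp add: f bicomplex_eq_iff_beta)
    also have "\<dots> = F (bc_e * bc_of_complex (beta1 Z) + bc_ed * bc_of_complex (beta2 Z))"
      unfolding F[OF Im] f1(2)[OF Im(1)] f2(2)[OF Im(2)] ..
    finally show ?thesis unfolding bicomplex_decomp[symmetric] ..
  qed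
  moreover have "D_nn_integral 0 \<infinity> (\<lambda>t. (hyp_norm (f t))\<^sup>2) = M"
  proof -
    have "D_nn_integral 0 \<infinity> (\<lambda>t. (hyp_norm (f t))\<^sup>2) =
        (\<integral>\<^sup>+t\<in>einterval 0 \<infinity>. ennreal ((cmod (f1 t))\<^sup>2) \<partial>lborel,
         \<integral>\<^sup>+t\<in>einterval 0 \<infinity>. ennreal ((cmod (f2 t))\<^sup>2) \<partial>lborel)"
      by (rule D_nn_integral_product) (simp add: f hyp_norm_def bicomplex_eq_iff_beta)
    then show ?thesis unfolding Ioi f1(3) f2(3) by simp
  qed
  ultimately show ?thesis by blast
qed

end
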